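(* Let $X$ be a closed Riemann surface of genus at least two with its conformal hyperbolic metric, $n\ge2$, and $q_n\in H^0(X,K^n)$. At the Fuchsian point of $\mathcal H(\Sigma,n)$ determined by $X$, the first variation of the trace of the holonomy along a closed geodesic $\gamma$ of length $\ell_\gamma$, in the direction of the standard Hitchin deformation $\psi^0(q_n)$, is $$d\operatorname{Tr}(\delta(\gamma))(\psi^0(q_n))=2(-1)^n(n-1)!\,\bigl(\sinh(\ell_\gamma/2)\bigr)^{n-1}\int_0^{\ell_\gamma}\Re\bigl(q_n(\dot\gamma,\dots,\dot\gamma)\bigr)\,ds ,$$ where $\gamma$ is parametrized by arc length and $q_n$ is evaluated on $n$ copies of the unit tangent vector.
   Context: Setting. $X$ is a closed Riemann surface of genus $\ge2$ with its conformal hyperbolic metric of curvature $-1$ and area form $d\sigma$; $\Sigma$ is the underlying oriented surface, $K$ the canonical bundle. Locally $d\sigma=i\,h\,dz\wedge d\bar z$, and the hermitian metric on $K^k$ is $\langle dz^k,dz^k\rangle=h^{-k}$. $\mathcal H(\Sigma,n)$ (the Hitchin component) is the set of conjugacy classes of representations $\pi_1(\Sigma)\to\mathsf{PSL}(n,\mathbb R)$, lifted to $\mathsf{SL}(n,\mathbb R)$ so that holonomies have positive eigenvalues, that can be continuously deformed to a Fuchsian one; the Fuchsian representation attached to $X$ is $\delta=\iota_n\circ\delta_X$, with $\delta_X$ the monodromy of the hyperbolic metric and $\iota_n$ the irreducible representation of $\mathsf{PSL}(2,\mathbb R)$ in $\mathsf{PSL}(n,\mathbb R)$; the $p$-th largest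 eigenvalue of $\delta(\gamma)$ is then $e^{(n+1-2p)\ell_\gamma/2}$. Standard deformation. Let $a,x,y$ be generators of $\mathfrak{sl}(2)$ with $[a,x]=x$, $[a,y]=-y$, $[x,y]=-a$, and $\kappa_n:\mathfrak{sl}(2)\to\mathfrak{sl}(n,\mathbb C)$ the irreducible embedding given in a unitary basis $\hat w_1,\dots,\hat w_n$ by $X_n=\kappa_n(x)$, $Y_n=\kappa_n(y)$, $-X_n\hat w_p=c_p\hat w_{p+1}$, $Y_n\hat w_p=c_{p-1}\hat w_{p-1}$, $c_p=(p(n-p)/2)^{1/2}$; so $Y_n=\rho(X_n)$ for $\rho(M)=-M^*$. Put $E^0_k=(-\sqrt2X_n)^k$. With $\mathfrak g_m$ the $m$-eigenspace of $\mathrm{ad}\,\kappa_n(a)$ on $\mathfrak{sl}(n,\mathbb C)$, let $\mathcal G=\bigoplus_m\mathfrak g_m\otimes K^m$, with the Cartan involutions $\rho$ induced by the hermitian metric on $K$, the Chern connection $\nabla$, and $\Phi_0=Y_n\otimes1\in\mathfrak g_{-1}\otimes K^{-1}\otimes K$. Then $D=\nabla+\Phi_0-\rho(\Phi_0)$ is flat with monodromy $\delta$. For $q\in H^0(X,K^k)$ set $\phi^0(q)=q\otimes E^0_{k-1}$ and $\psi^0(q)=\phi^0(q)-\rho(\phi^0(q))$; this is a $D$-closed real $1$-form whose class is a tangent vector in $\mathsf T_\delta\mathcal H(\Sigma,n)$.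
   Formalization: The unit tangent vector and ds in the integral are normalised by the hermitian metric on K^{-1} (norm² h|v|²), not the curvature −1 metric 2h|dz|²; with the latter the printed right side is too small by the factor 2^{(n-1)/2}, so the formula as printed is false. *)

theory Defs
  imports
    "HOL-Complex_Analysis.Complex_Analysis"
    "HOL-Homology.Homology"
    "HOL-Algebra.Free_Abelian_Groups"
    "Jordan_Normal_Form.Char_Poly"
begin

section \<open>Closed Riemann surfaces\<close>

text \<open>The underlying space of the surface is a whole type; a chart is a pair of a coordinate
  neighbourhood and a complex coordinate on it (only the values on the neighbourhood matter).\<close>

type_synonym 'a chart = "'a set \<times> ('a \<Rightarrow> complex)"

definition is_chart :: "'a::topological_space chart \<Rightarrow> bool" where
  "is_chart c \<longleftrightarrow> open (fst c) \<and> open (snd c ` fst c) \<and>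
     (\<exists>g. homeomorphism (fst c) (snd c ` fst c) (snd c) g)"

definition coord_change :: "'a chart \<Rightarrow> 'a chart \<Rightarrow> complex \<Rightarrow> complex" where
  "coord_change c d = snd d \<circ> inv_into (fst c) (snd c)"

definition complex_atlas :: "'a::topological_space chart set \<Rightarrow> bool" where
  "complex_atlas \<A> \<longleftrightarrow> (\<forall>c\<in>\<A>. is_chart c) \<and> (\<Union>c\<in>\<A>. fst c) = UNIV \<and>
     (\<forall>c\<in>\<A>. \<forall>d\<in>\<A>. coord_change c d holomorphic_on snd c ` (fst c \<inter> fst d))"

definition closed_riemann_surface :: "'a::t2_space chart set \<Rightarrow> bool" where
  "closed_riemann_surface \<A> \<longleftrightarrow>
     complex_atlas \<A> \<and> compact (UNIV :: 'a set) \<and> connected (UNIV :: 'a set)"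

definition has_genus :: "'a::topological_space itself \<Rightarrow> nat \<Rightarrow> bool" where
  "has_genus _ g \<longleftrightarrow>
     homology_group 1 (euclidean :: 'a topology) \<cong> free_Abelian_group {..<2 * g}"

section \<open>The hyperbolic metric and holomorphic differentials\<close>

definition Dx :: "(complex \<Rightarrow> 'b::real_normed_vector) \<Rightarrow> complex \<Rightarrow> 'b" where
  "Dx f z = frechet_derivative f (at z) 1"

definition Dy :: "(complex \<Rightarrow> 'b::real_normed_vector) \<Rightarrow> complex \<Rightarrow> 'b" where
  "Dy f z = frechet_derivative f (at z) \<i>"

fun C_times :: "nat \<Rightarrow> complex set \<Rightarrow> (complex \<Rightarrow> real) \<Rightarrow> bool" where
  "C_times 0 S f \<longleftrightarrow> continuous_on S f"
| "C_times (Suc k) S f \<longleftrightarrow>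
     (\<forall>z\<in>S. f differentiable (at z)) \<and> C_times k S (Dx f) \<and> C_times k S (Dy f)"

definition smooth_on :: "complex set \<Rightarrow> (complex \<Rightarrow> real) \<Rightarrow> bool" where
  "smooth_on S f \<longleftrightarrow> (\<forall>k. C_times k S f)"

definition del_z :: "(complex \<Rightarrow> real) \<Rightarrow> complex \<Rightarrow> complex" where
  "del_z f z = (complex_of_real (Dx f z) - \<i> * complex_of_real (Dy f z)) / 2"

definition gauss_curvature :: "(complex \<Rightarrow> real) \<Rightarrow> complex \<Rightarrow> real" where
  \<comment> \<open>of the conformal metric $\lambda\,|dz|^2$\<close>
  "gauss_curvature l z =
     - (Dx (Dx (\<lambda>w. ln (l w))) z + Dy (Dy (\<lambda>w. ln (l w))) z) / (2 * l z)"

text \<open>The area form is $i\,h\,dz\wedge d\bar z = 2h\,dx\wedge dy$, so the Riemannian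
  metric is $2h\,|dz|^2$. The function \<open>h c\<close> is the density in the chart \<open>c\<close>.\<close>

definition hyperbolic_metric ::
  "'a::topological_space chart set \<Rightarrow> ('a chart \<Rightarrow> complex \<Rightarrow> real) \<Rightarrow> bool" where
  "hyperbolic_metric \<A> h \<longleftrightarrow>
     (\<forall>c\<in>\<A>. smooth_on (snd c ` fst c) (h c) \<and>
        (\<forall>z\<in>snd c ` fst c. h c z > 0 \<and> gauss_curvature (\<lambda>w. 2 * h c w) z = -1)) \<and>
     (\<forall>c\<in>\<A>. \<forall>d\<in>\<A>. \<forall>x\<in>fst c \<inter> fst d.
        h c (snd c x) = h d (snd d x) * (cmod (deriv (coord_change c d) (snd c x)))\<^sup>2)"

text \<open>Elements of $H^0(X,K^k)$; \<open>q c\<close> is the coefficient of $dz^k$ in the chart \<open>c\<close>.\<close>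

definition holomorphic_differential ::
  "'a::topological_space chart set \<Rightarrow> nat \<Rightarrow> ('a chart \<Rightarrow> complex \<Rightarrow> complex) \<Rightarrow> bool" where
  "holomorphic_differential \<A> k q \<longleftrightarrow>
     (\<forall>c\<in>\<A>. q c holomorphic_on snd c ` fst c) \<and>
     (\<forall>c\<in>\<A>. \<forall>d\<in>\<A>. \<forall>x\<in>fst c \<inter> fst d.
        q c (snd c x) = q d (snd d x) * deriv (coord_change c d) (snd c x) ^ k)"

section \<open>Closed geodesics\<close>

definition velocity :: "'a chart \<Rightarrow> (real \<Rightarrow> 'a) \<Rightarrow> real \<Rightarrow> complex" where
  "velocity c g s = vector_derivative (snd c \<circ> g) (at s)"

text \<open>Arc length is that of $2h\,|dz|^2$, whose geodesic equation is
  $\ddot z + \partial_z(\log h)\,\dot z^2 = 0$.\<close>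

definition closed_geodesic ::
  "'a::topological_space chart set \<Rightarrow> ('a chart \<Rightarrow> complex \<Rightarrow> real) \<Rightarrow> (real \<Rightarrow> 'a) \<Rightarrow> real \<Rightarrow> bool" where
  "closed_geodesic \<A> h g l \<longleftrightarrow> l > 0 \<and> continuous_on UNIV g \<and> (\<forall>s. g (s + l) = g s) \<and>
     (\<forall>c\<in>\<A>. \<forall>s. g s \<in> fst c \<longrightarrow>
        (snd c \<circ> g) differentiable (at s) \<and>
        2 * h c (snd c (g s)) * (cmod (velocity c g s))\<^sup>2 = 1 \<and>
        (velocity c g has_vector_derivative
           - del_z (\<lambda>w. ln (h c w)) (snd c (g s)) * (velocity c g s)\<^sup>2) (at s))"

definition geodesic_loop :: "(real \<Rightarrow> 'a) \<Rightarrow> real \<Rightarrow> real \<Rightarrow> 'a" where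
  "geodesic_loop g l = (\<lambda>s. g (l * s))"

definition chart_at :: "'a chart set \<Rightarrow> 'a \<Rightarrow> 'a chart" where
  "chart_at \<A> x = (SOME c. c \<in> \<A> \<and> x \<in> fst c)"

text \<open>Norm of $v\,\partial_z$ for the hermitian metric on $K^{-1}$ dual to
  $\langle dz,dz\rangle = h^{-1}$. A unit vector of $2h\,|dz|^2$ has norm $1/\sqrt2$ here.\<close>

definition K_norm :: "('a chart \<Rightarrow> complex \<Rightarrow> real) \<Rightarrow> 'a chart \<Rightarrow> complex \<Rightarrow> complex \<Rightarrow> real" where
  "K_norm h c z v = sqrt (h c z) * cmod v"

text \<open>The density of $\Re\,q(u,\dots,u)\,|d\gamma|$ along the curve \<open>g\<close>, where $u$ is its
  unit tangent vector and $|d\gamma|$ its length element. Both are normalised by the hermitian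
  metric on $K^{-1}$ in which the fibre metric, the Cartan involution and hence the standard
  deformation below are written. With unit vectors and length element of $2h\,|dz|^2$ instead,
  the value would be smaller by the factor $2^{(k-1)/2}$. The expression does not depend on the
  chart, nor on the parametrisation apart from the usual change of variables.\<close>

definition Re_differential_density ::
  "'a chart set \<Rightarrow> ('a chart \<Rightarrow> complex \<Rightarrow> real) \<Rightarrow> nat \<Rightarrow> ('a chart \<Rightarrow> complex \<Rightarrow> complex) \<Rightarrow>
    (real \<Rightarrow> 'a) \<Rightarrow> real \<Rightarrow> real" where
  "Re_differential_density \<A> h k q g s =
     (let c = chart_at \<A> (g s); z = snd c (g s); v = velocity c g s;
          u = v / complex_of_real (K_norm h c z v)
      in Re (q c z * u ^ k) * K_norm h c z v)"

section \<open>The flat bundle of the Fuchsian point and the standard deformation\<close>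

text \<open>Matrices are indexed from 0, so the basis vector $\hat w_p$ has index \<open>p - 1\<close>. Since
  $\kappa_n(a)$ is the diagonal matrix with entries $p-(n+1)/2$, the elementary matrix with
  entry at \<open>(i, j)\<close> has weight \<open>i - j\<close>, i.e. it spans part of $\mathfrak g_{i-j}$.\<close>

definition c_coeff :: "nat \<Rightarrow> nat \<Rightarrow> complex" where
  "c_coeff n p = complex_of_real (sqrt (real p * (real n - real p) / 2))"

definition X_mat :: "nat \<Rightarrow> complex mat" where
  "X_mat n = mat n n (\<lambda>(i, j). if i = j + 1 then - c_coeff n (j + 1) else 0)"

definition Y_mat :: "nat \<Rightarrow> complex mat" where
  "Y_mat n = mat n n (\<lambda>(i, j). if j = i + 1 then c_coeff n j else 0)"

definition E0_mat :: "nat \<Rightarrow> nat \<Rightarrow> complex mat" where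
  "E0_mat n k = (complex_of_real (- sqrt 2) \<cdot>\<^sub>m X_mat n) ^\<^sub>m k"

text \<open>In a chart, an element of $\mathcal G=\bigoplus_m\mathfrak g_m\otimes K^m$ is the matrix
  of its coefficients with respect to the frames $dz^m$. A 1-form is the real-linear function
  that sends a tangent vector $\dot z$ to such a matrix.

  If \<open>t\<close> is the derivative of the new coordinate \<open>w\<close> with respect to \<open>z\<close>, then
  $dw^m = t^m\,dz^m$.\<close>

definition G_transition :: "nat \<Rightarrow> complex \<Rightarrow> complex mat \<Rightarrow> complex mat" where
  "G_transition n t M = mat n n (\<lambda>(i, j). t powi (int i - int j) * M $$ (i, j))"

text \<open>The antilinear extension of $M\otimes dz^m\mapsto -M^*\otimes h^{-m}\,dz^{-m}$
  for $M\in\mathfrak g_m$: here $\langle dz^m,dz^m\rangle = h^{-m}$, and the entry of $M^*$ at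
  \<open>(i, j)\<close> comes from weight \<open>j - i\<close>.\<close>

definition cartan_inv :: "nat \<Rightarrow> real \<Rightarrow> complex mat \<Rightarrow> complex mat" where
  "cartan_inv n h M =
     mat n n (\<lambda>(i, j). - cnj (M $$ (j, i)) * complex_of_real (h powi (int i - int j)))"

definition Phi0 :: "nat \<Rightarrow> complex \<Rightarrow> complex mat" where
  "Phi0 n v = v \<cdot>\<^sub>m Y_mat n"

definition lie_bracket :: "complex mat \<Rightarrow> complex mat \<Rightarrow> complex mat" where
  "lie_bracket A B = A * B - B * A"

text \<open>\<open>D_form n h c z v u\<close> is the zero-order part of $D_v u$. The Chern connection form of
  $K^m$ in the frame $dz^m$ is $\partial\log h^{-m} = -m\,\partial_z(\log h)\,dz$.\<close>

definition chern_form ::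
  "nat \<Rightarrow> ('a chart \<Rightarrow> complex \<Rightarrow> real) \<Rightarrow> 'a chart \<Rightarrow> complex \<Rightarrow> complex \<Rightarrow> complex mat \<Rightarrow> complex mat" where
  "chern_form n h c z v u = mat n n (\<lambda>(i, j).
     - of_int (int i - int j) * del_z (\<lambda>w. ln (h c w)) z * v * u $$ (i, j))"

definition D_form ::
  "nat \<Rightarrow> ('a chart \<Rightarrow> complex \<Rightarrow> real) \<Rightarrow> 'a chart \<Rightarrow> complex \<Rightarrow> complex \<Rightarrow> complex mat \<Rightarrow> complex mat" where
  "D_form n h c z v u = chern_form n h c z v u +
     lie_bracket (Phi0 n v - cartan_inv n (h c z) (Phi0 n v)) u"

definition phi0 ::
  "nat \<Rightarrow> nat \<Rightarrow> ('a chart \<Rightarrow> complex \<Rightarrow> complex) \<Rightarrow> 'a chart \<Rightarrow> complex \<Rightarrow> complex \<Rightarrow> complex mat" where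
  "phi0 n k q c z v = (q c z * v) \<cdot>\<^sub>m E0_mat n (k - 1)"

definition psi0 ::
  "nat \<Rightarrow> ('a chart \<Rightarrow> complex \<Rightarrow> real) \<Rightarrow> nat \<Rightarrow> ('a chart \<Rightarrow> complex \<Rightarrow> complex) \<Rightarrow>
    'a chart \<Rightarrow> complex \<Rightarrow> complex \<Rightarrow> complex mat" where
  "psi0 n h k q c z v = phi0 n k q c z v - cartan_inv n (h c z) (phi0 n k q c z v)"

subsection \<open>Sections along curves\<close>

definition mat_trace :: "'b::comm_ring_1 mat \<Rightarrow> 'b" where
  "mat_trace M = (\<Sum>i<dim_row M. M $$ (i, i))"

text \<open>Sections of the pull-back of $\mathcal G$ by a curve on \<open>{0..1}\<close>, given in all charts.\<close>

definition G_section_along ::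
  "'a chart set \<Rightarrow> nat \<Rightarrow> (real \<Rightarrow> 'a) \<Rightarrow> ('a chart \<Rightarrow> real \<Rightarrow> complex mat) \<Rightarrow> bool" where
  "G_section_along \<A> n p u \<longleftrightarrow>
     (\<forall>c\<in>\<A>. \<forall>s\<in>{0..1}. p s \<in> fst c \<longrightarrow> u c s \<in> carrier_mat n n \<and> mat_trace (u c s) = 0) \<and>
     (\<forall>c\<in>\<A>. \<forall>d\<in>\<A>. \<forall>s\<in>{0..1}. p s \<in> fst c \<inter> fst d \<longrightarrow>
        u c s = G_transition n (deriv (coord_change c d) (snd c (p s))) (u d s))"

text \<open>$D_{\dot p}\,u = \alpha(\dot p)$ for a $\mathcal G$-valued 1-form \<open>\<alpha>\<close>, with
  finitely many exceptional parameters as usual for piecewise differentiable curves.\<close>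

definition D_along_eq ::
  "'a::topological_space chart set \<Rightarrow> nat \<Rightarrow> ('a chart \<Rightarrow> complex \<Rightarrow> real) \<Rightarrow> (real \<Rightarrow> 'a) \<Rightarrow>
    ('a chart \<Rightarrow> real \<Rightarrow> complex mat) \<Rightarrow> ('a chart \<Rightarrow> complex \<Rightarrow> complex \<Rightarrow> complex mat) \<Rightarrow> bool" where
  "D_along_eq \<A> n h p u \<alpha> \<longleftrightarrow>
     (\<forall>c\<in>\<A>. \<forall>a b. 0 \<le> a \<and> a < b \<and> b \<le> 1 \<and> p ` {a..b} \<subseteq> fst c \<longrightarrow>
        (\<forall>i<n. \<forall>j<n. continuous_on {a..b} (\<lambda>s. u c s $$ (i, j))) \<and>
        (\<exists>S. finite S \<and> (\<forall>s\<in>{a..b} - S. \<forall>i<n. \<forall>j<n.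
           ((\<lambda>s. u c s $$ (i, j)) has_vector_derivative
              (\<alpha> c (snd c (p s)) (velocity c p s)
                 - D_form n h c (snd c (p s)) (velocity c p s) (u c s)) $$ (i, j)) (at s))))"

definition D_parallel where
  "D_parallel \<A> n h p u \<longleftrightarrow>
     G_section_along \<A> n p u \<and> D_along_eq \<A> n h p u (\<lambda>_ _ _. 0\<^sub>m n n)"

section \<open>Representations of the fundamental group\<close>

definition loops_at :: "'a::topological_space \<Rightarrow> (real \<Rightarrow> 'a) set" where
  "loops_at x = {p. path p \<and> pathstart p = x \<and> pathfinish p = x}"

definition pw_C1_loops_at :: "'a::topological_space chart set \<Rightarrow> 'a \<Rightarrow> (real \<Rightarrow> 'a) set" where
  "pw_C1_loops_at \<A> x = {p \<in> loops_at x. \<forall>c\<in>\<A>. \<forall>a b.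
     0 \<le> a \<and> a < b \<and> b \<le> 1 \<and> p ` {a..b} \<subseteq> fst c \<longrightarrow>
     (snd c \<circ> p) piecewise_C1_differentiable_on {a..b}}"

abbreviation cmat :: "real mat \<Rightarrow> complex mat" where
  "cmat \<equiv> map_mat complex_of_real"

text \<open>Representations of the fundamental group in $\mathsf{PSL}(n,\mathbb R)$, each holonomy being
  lifted to the element of $\mathsf{SL}(n,\mathbb R)$ with positive eigenvalues. For even \<open>n\<close>
  these lifts are multiplicative only up to sign. For odd \<open>n\<close> the sign is \<open>+\<close> because
  determinants are 1. Holonomies are parallel transports, hence composed like maps: the loop
  \<open>p +++ p'\<close>, which runs through \<open>p\<close> first, has holonomy \<open>R p' * R p\<close>.\<close>

definition lifted_PSL_rep :: "nat \<Rightarrow> 'a::topological_space \<Rightarrow> ((real \<Rightarrow> 'a) \<Rightarrow> real mat) \<Rightarrow> bool" where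
  "lifted_PSL_rep n x R \<longleftrightarrow>
     (\<forall>p\<in>loops_at x. R p \<in> carrier_mat n n \<and> Determinant.det (R p) = 1 \<and>
        (\<forall>k. eigenvalue (cmat (R p)) k \<longrightarrow> k \<in> \<real> \<and> Re k > 0)) \<and>
     (\<forall>p\<in>loops_at x. \<forall>p'\<in>loops_at x. homotopic_paths UNIV p p' \<longrightarrow> R p = R p') \<and>
     (\<forall>p\<in>loops_at x. \<forall>p'\<in>loops_at x. R (p +++ p') = R p' * R p \<or> R (p +++ p') = - (R p' * R p))"

text \<open>The representations that can be continuously deformed to \<open>\<delta>\<close>. For \<open>\<delta>\<close> Fuchsian, their
  conjugacy classes form the Hitchin component.\<close>

definition hitchin_reps ::
  "nat \<Rightarrow> 'a::topological_space \<Rightarrow> ((real \<Rightarrow> 'a) \<Rightarrow> real mat) \<Rightarrow> ((real \<Rightarrow> 'a) \<Rightarrow> real mat) set" where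
  "hitchin_reps n x \<delta> = {R. \<exists>r :: real \<Rightarrow> (real \<Rightarrow> 'a) \<Rightarrow> real mat.
     (\<forall>t\<in>{0..1}. lifted_PSL_rep n x (r t)) \<and>
     (\<forall>p\<in>loops_at x. \<forall>i<n. \<forall>j<n. continuous_on {0..1} (\<lambda>t. r t p $$ (i, j))) \<and>
     (\<forall>p\<in>loops_at x. r 0 p = \<delta> p \<and> r 1 p = R p)}"

text \<open>The monodromy of \<open>D\<close> acts on the fibre of $\mathcal G$ at the base point. In the chart
  \<open>c0\<close> this fibre is $\mathfrak{sl}(n,\mathbb C)$, and \<open>M \<mapsto> P * M * Q\<close> with \<open>Q\<close> inverse
  to \<open>P\<close> identifies it with the complexification of $\mathfrak{sl}(n,\mathbb R)$. The element of
  $\mathsf{SL}(n,\mathbb R)$ with positive eigenvalues that induces the monodromy along a loop is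
  unique, so the following determines \<open>\<delta>\<close> up to conjugation.\<close>

definition inverse_mats :: "nat \<Rightarrow> complex mat \<Rightarrow> complex mat \<Rightarrow> bool" where
  "inverse_mats n P Q \<longleftrightarrow> P \<in> carrier_mat n n \<and> Q \<in> carrier_mat n n \<and>
     P * Q = 1\<^sub>m n \<and> Q * P = 1\<^sub>m n"

definition is_monodromy_of_D ::
  "'a::topological_space chart set \<Rightarrow> nat \<Rightarrow> ('a chart \<Rightarrow> complex \<Rightarrow> real) \<Rightarrow> 'a \<Rightarrow> 'a chart \<Rightarrow>
    complex mat \<Rightarrow> complex mat \<Rightarrow> ((real \<Rightarrow> 'a) \<Rightarrow> real mat) \<Rightarrow> bool" where
  "is_monodromy_of_D \<A> n h x c0 P Q \<delta> \<longleftrightarrow> lifted_PSL_rep n x \<delta> \<and>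
     (\<forall>p\<in>pw_C1_loops_at \<A> x. \<forall>u. D_parallel \<A> n h p u \<longrightarrow>
        (P * u c0 1 * Q) * cmat (\<delta> p) = cmat (\<delta> p) * (P * u c0 0 * Q))"

section \<open>Tangent vectors\<close>

text \<open>The tangent space of the Hitchin component at $[\delta]$ is the first cohomology of the
  fundamental group with coefficients in $\mathfrak{sl}(n,\mathbb R)$, twisted by $\delta$. A path
  $R_t$ with $R_0=\delta$ has the tangent cocycle $p\mapsto\dot R_0(p)\,\delta(p)^{-1}$.

  The class of a \<open>D\<close>-closed 1-form \<open>\<psi>\<close> is the variation of the monodromy of a family
  of flat connections $D+t\psi+o(t)$. Differentiating the equation of parallel transport shows
  that it is represented by the cocycle $p\mapsto\xi(1)$, where \<open>\<xi>\<close> is the section along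
  \<open>p\<close> with $D_{\dot p}\,\xi = -\psi(\dot p)$ and $\xi(0)=0$.

  The matrix \<open>B\<close> below accounts for coboundaries.\<close>

definition rep_path_velocity ::
  "nat \<Rightarrow> (real \<Rightarrow> (real \<Rightarrow> 'a) \<Rightarrow> real mat) \<Rightarrow> (real \<Rightarrow> 'a) \<Rightarrow> real mat" where
  "rep_path_velocity n R p = mat n n (\<lambda>(i, j). deriv (\<lambda>t. R t p $$ (i, j)) 0)"

definition tangent_class_of_form ::
  "'a::topological_space chart set \<Rightarrow> nat \<Rightarrow> ('a chart \<Rightarrow> complex \<Rightarrow> real) \<Rightarrow> 'a \<Rightarrow> 'a chart \<Rightarrow>
    complex mat \<Rightarrow> complex mat \<Rightarrow> (real \<Rightarrow> (real \<Rightarrow> 'a) \<Rightarrow> real mat) \<Rightarrow>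
    ('a chart \<Rightarrow> complex \<Rightarrow> complex \<Rightarrow> complex mat) \<Rightarrow> bool" where
  "tangent_class_of_form \<A> n h x c0 P Q R \<psi> \<longleftrightarrow>
     (\<forall>p\<in>loops_at x. \<forall>i<n. \<forall>j<n. (\<lambda>t. R t p $$ (i, j)) differentiable (at 0)) \<and>
     (\<exists>B\<in>carrier_mat n n. mat_trace B = 0 \<and>
        (\<forall>p\<in>pw_C1_loops_at \<A> x. \<forall>\<xi>.
           G_section_along \<A> n p \<xi> \<and> D_along_eq \<A> n h p \<xi> (\<lambda>c z v. - \<psi> c z v) \<and>
           \<xi> c0 0 = 0\<^sub>m n n \<longrightarrow>
           cmat (rep_path_velocity n R p) =
             (P * \<xi> c0 1 * Q) * cmat (R 0 p) + cmat (B * R 0 p - R 0 p * B)))"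

end

theory Submission
  imports Defs
begin

text \<open>Along the geodesic trivialise $\mathcal G$ by powers of the parallel vector $\sqrt2\,\dot\gamma$.
  Then $D$ becomes $d/ds+\mathrm{ad}\,S$ with the constant symmetric matrix $S=(Y_n-X_n)/\sqrt2$, so the
  holonomy is conjugate to $e^{-\ell S}$, and $\psi^0(q_n)$ has only the two extreme off-diagonal
  entries. As $e^{-\ell S}$ commutes with parallel transport, the variation of the trace is
  $-\int_0^\ell\mathrm{tr}(\psi^0(\dot\gamma)\,e^{-\ell S})\,ds$; the two extreme entries of $e^{-\ell S}$ are
  $(-\sinh(\ell/2))^{n-1}$. This follows from the explicit eigenvectors of $S$, which are given by
  Krawtchouk polynomials, the coefficients of $(1+x)^{n-1-i}(1-x)^i$.\<close>

section \<open>Krawtchouk polynomials and the spin matrix\<close>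

text \<open>Monodromy and tangent class are both given as statements about every section that solves
  a transport equation along the loop, so it is enough to write down explicit solutions; once S is
  diagonal these are variation of constants, entry by entry. The holonomy is accessible only through
  its adjoint action, which leaves a scalar to be determined. The equation becomes constant because
  the geodesic equation for the velocity cancels the Chern connection form, and S is symmetric
  because both parts of the Higgs form have the same size on a vector of norm 1. Origin of the
  constants: (n-1)! is the product of all the matrix entries met by the top power of -sqrt 2 X_n;
  the two extreme entries of psi^0 are complex conjugate, hence 2 Re; diagonalising S turns the
  trace into the binomial expansion of ((e^(-l/2) - e^(l/2))/2)^(n-1); and the minus sign in D xi =
  -psi^0 combines with the sign of that power to give (-1)^n.\<close>

definition kraw :: "nat \<Rightarrow> nat \<Rightarrow> nat \<Rightarrow> real" where
  "kraw N i j = Polynomial.coeff ([:1, 1:] ^ (N - i) * [:1, -1:] ^ i) j"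

lemma coeff_one_plus_power: "Polynomial.coeff ([:1, 1:] ^ N) j = (of_nat (N choose j) :: real)"
proof (cases "j \<le> N")
  case True
  then show ?thesis
    using coeff_linear_poly_power[of j N "1::real" 1] by simp
next
  case False
  then have "Polynomial.degree ([:1, 1:] ^ N :: real poly) < j"
    by (simp add: degree_power_eq)
  then show ?thesis using False by (simp add: coeff_eq_0)
qed

lemma degree_one_plus_one_minus:
  assumes "i \<le> N"
  shows "Polynomial.degree ([:1, 1:] ^ (N - i) * [:1, -1:] ^ i :: real poly) \<le> N"
proof -
  have "Polynomial.degree ([:1, 1:] ^ (N - i) * [:1, -1:] ^ i :: real poly)
      \<le> Polynomial.degree ([:1, 1:] ^ (N - i) :: real poly) + Polynomial.degree ([:1, -1:] ^ i :: real poly)"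
    by (rule degree_mult_le)
  also have "\<dots> \<le> (N - i) + i"
    by (intro add_mono order.trans[OF degree_power_le]) auto
  finally show ?thesis using assms by simp
qed

text \<open>The deformation lives in the two extreme entries of a matrix, so conjugating it by the
  eigenvectors reads off only the boundary of the Krawtchouk table: the first and last rows and
  columns.\<close>

lemma kraw_first_row: "kraw N 0 j = of_nat (N choose j)"
  by (simp add: kraw_def coeff_one_plus_power)

lemma kraw_last_row: "kraw N N j = (-1) ^ j * of_nat (N choose j)"
proof (cases "j \<le> N")
  case True
  then show ?thesis
    using coeff_linear_poly_power[of j N "1::real" "-1"] by (simp add: kraw_def)
next
  case False
  then show ?thesis
    using degree_one_plus_one_minus[of N N] by (simp add: kraw_def coeff_eq_0)
qed

lemma kraw_first_column: "kraw N i 0 = 1"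
  by (simp add: kraw_def coeff_0_power coeff_mult_0)

lemma kraw_last_column:
  assumes "i \<le> N"
  shows "kraw N i N = (-1) ^ i"
proof -
  have d: "Polynomial.degree ([:1, 1:] ^ (N - i) * [:1, -1:] ^ i :: real poly) = N"
    using assms by (simp add: degree_mult_eq degree_power_eq)
  have "kraw N i N = Polynomial.lead_coeff ([:1, 1:] ^ (N - i) * [:1, -1:] ^ i :: real poly)"
    by (simp only: d kraw_def)
  then show ?thesis
    by (simp add: lead_coeff_mult lead_coeff_power)
qed

text \<open>The Moebius map y = (1-x)/(1+x) is an involution. Homogenised in degree N it sends x^i
  to the i-th Krawtchouk generating function, and applied twice it multiplies by 2^N, because
  (1+x)(1+y) = 2 and (1+x)(1-y) = 2x. The sum is coefficient j of the second image T.\<close>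

lemma kraw_involution:
  assumes i: "i \<le> N" and j: "j \<le> N"
  shows "(\<Sum>k\<le>N. kraw N i k * kraw N k j) = (if i = j then 2 ^ N else 0)"
proof -
  let ?F = "\<lambda>i. [:1, 1:] ^ (N - i) * [:1, -1:] ^ i :: real poly"
  define T where "T = (\<Sum>k\<le>N. Polynomial.smult (kraw N i k) (?F k))"
  have eval: "poly T x = 2 ^ N * x ^ i" if x: "x \<noteq> -1" for x
  proof -
    define y where "y = (1 - x) / (1 + x)"
    have x0: "1 + x \<noteq> 0" using x by linarith
    have "poly T x = (\<Sum>k\<le>N. kraw N i k * ((1 + x) ^ (N - k) * (1 - x) ^ k))"
      by (simp add: T_def poly_sum)
    also have "\<dots> = (\<Sum>k\<le>N. (1 + x) ^ N * (kraw N i k * y ^ k))"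
      by (intro sum.cong refl) (use x0 in \<open>simp add: y_def field_simps power_diff\<close>)
    also have "\<dots> = (1 + x) ^ N * (\<Sum>k\<le>N. kraw N i k * y ^ k)"
      by (simp add: sum_distrib_left)
    also have "(\<Sum>k\<le>N. kraw N i k * y ^ k) = poly (?F i) y"
      using arg_cong[OF poly_as_sum_of_monoms'[OF degree_one_plus_one_minus[OF i]], of "\<lambda>p. poly p y"]
      by (simp add: kraw_def poly_sum poly_monom)
    also have "(1 + x) ^ N * poly (?F i) y
        = ((1 + x) * (1 + y)) ^ (N - i) * ((1 + x) * (1 - y)) ^ i"
    proof -
      have "(1 + x) ^ N = (1 + x) ^ (N - i) * (1 + x) ^ i"
        using i by (simp flip: power_add)
      then show ?thesis unfolding power_mult_distrib by (simp add: add.commute)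
    qed
    also have "(1 + x) * (1 + y) = 2" using x0 by (simp add: y_def field_simps)
    also have "(1 + x) * (1 - y) = 2 * x" using x0 by (simp add: y_def field_simps)
    also have "2 ^ (N - i) * (2 * x) ^ i = 2 ^ N * x ^ i"
      using i by (simp add: power_mult_distrib flip: power_add)
    finally show ?thesis .
  qed
  \<comment> \<open>The value y is undefined at x = -1, but agreement at all other real x already
    forces equality of polynomials.\<close>
  have "T - Polynomial.monom (2 ^ N) i = 0"
  proof (rule ccontr)
    assume "T - Polynomial.monom (2 ^ N) i \<noteq> 0"
    then have "finite {x. poly (T - Polynomial.monom (2 ^ N) i) x = 0}"
      by (rule poly_roots_finite)
    moreover have "- {-1} \<subseteq> {x. poly (T - Polynomial.monom (2 ^ N) i) x = 0}"
      using eval by (auto simp: poly_monom)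
    ultimately have "finite (- {-1 :: real})" by (rule rev_finite_subset)
    then show False by (metis finite_compl finite.emptyI finite_insert infinite_UNIV_char_0)
  qed
  then have "Polynomial.coeff T j = Polynomial.coeff (Polynomial.monom (2 ^ N) i) j" by simp
  then show ?thesis by (simp add: T_def coeff_sum kraw_def)
qed

text \<open>Compare coefficients in $(1-x^2)f'+Nxf=(N-2i)f$ for $f=(1+x)^{N-i}(1-x)^i$.\<close>

lemma kraw_recurrence:
  assumes i: "i \<le> N"
  shows "real (Suc j) * kraw N i (Suc j) + (real N - (real j - 1)) * (if j = 0 then 0 else kraw N i (j - 1))
    = (real N - 2 * real i) * kraw N i j"
proof -
  let ?a = "[:1, 1:] :: real poly" and ?b = "[:1, -1:] :: real poly"
  define f where "f = ?a ^ (N - i) * ?b ^ i"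
  \<comment> \<open>Multiplying by the base restores the power lost in differentiation and so avoids
    the truncated exponent m - 1.\<close>
  have pa: "?a * pderiv (?a ^ m) = Polynomial.smult (real m) (?a ^ m)" for m
  proof (cases m)
    case (Suc k)
    have "pderiv ?a = 1" by (simp add: pderiv_pCons)
    then show ?thesis
      by (simp only: Suc pderiv_power_Suc, simp only: power_Suc mult_smult_left mult_smult_right mult_1_right)
  qed simp
  have pb: "?b * pderiv (?b ^ m) = Polynomial.smult (- real m) (?b ^ m)" for m
  proof (cases m)
    case (Suc k)
    have "pderiv ?b = -1" by (simp add: pderiv_pCons one_pCons)
    then show ?thesis
      by (simp only: Suc pderiv_power_Suc, simp only: power_Suc mult_smult_left mult_smult_right
          mult_minus_right mult_1_right smult_minus_left smult_minus_right)
  qed simp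
  have "?a * ?b * pderiv f = ?b * (?a * pderiv (?a ^ (N - i))) * ?b ^ i
      + ?a * (?b * pderiv (?b ^ i)) * ?a ^ (N - i)"
    by (simp only: f_def pderiv_mult) (simp only: algebra_simps)
  also have "\<dots> = Polynomial.smult (real (N - i)) (?b * f) + Polynomial.smult (- real i) (?a * f)"
    by (simp only: pa pb f_def mult_smult_left mult_smult_right mult_ac)
  also have "\<dots> = (Polynomial.smult (real (N - i)) ?b + Polynomial.smult (- real i) ?a) * f"
    by (simp only: distrib_right mult_smult_left)
  also have "Polynomial.smult (real (N - i)) ?b + Polynomial.smult (- real i) ?a
      = [:real N - 2 * real i, - real N:]"
    using i by (simp add: of_nat_diff)
  finally have eq: "?a * ?b * pderiv f = [:real N - 2 * real i, - real N:] * f" .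
  have "?a * ?b = [:1, 0, -1:]" by simp
  then have "Polynomial.coeff ([:1, 0, -1:] * pderiv f) j = Polynomial.coeff ([:real N - 2 * real i, - real N:] * f) j"
    using eq by simp
  then show ?thesis
    unfolding kraw_def f_def[symmetric]
    by (cases j; cases "j - 1") (auto simp: coeff_pderiv algebra_simps of_nat_diff)
qed

section \<open>The symmetrised recurrence and the eigenvectors of the spin matrix\<close>

lemma kraw_beyond:
  assumes "i \<le> N" "N < j"
  shows "kraw N i j = 0"
  using degree_one_plus_one_minus[OF assms(1)] assms(2) by (simp add: kraw_def coeff_eq_0)

text \<open>By (j+1) C(N,j+1) = (N-j) C(N,j), the product under the root is a perfect square times a
  binomial. Hence division by roots of binomials turns the unequal neighbour coefficients j+1 and
  N-j of the Krawtchouk recurrence into the symmetric entries of S.\<close>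

lemma sqrt_binomial_Suc:
  assumes "j < N"
  shows "sqrt (real (Suc j) * (real N - real j)) * sqrt (real (N choose j)) = real (Suc j) * sqrt (real (N choose Suc j))"
    and "sqrt (real (Suc j) * (real N - real j)) * sqrt (real (N choose Suc j)) = (real N - real j) * sqrt (real (N choose j))"
proof -
  have "Suc j * (N choose Suc j) = (N - j) * (N choose j)"
    using assms by (metis binomial_absorb_comp binomial_absorption mult.commute)
  then have b: "real (Suc j) * real (N choose Suc j) = (real N - real j) * real (N choose j)"
    using assms by (metis of_nat_mult of_nat_diff less_imp_le)
  have "sqrt (real (Suc j) * (real N - real j)) * sqrt (real (N choose j))
      = sqrt (real (Suc j) * ((real N - real j) * real (N choose j)))"
    by (simp flip: real_sqrt_mult add: mult.assoc)
  also have "\<dots> = sqrt ((real (Suc j))\<^sup>2 * real (N choose Suc j))"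
    unfolding b[symmetric] by (simp only: power2_eq_square mult.assoc)
  also have "\<dots> = real (Suc j) * sqrt (real (N choose Suc j))"
    by (simp only: real_sqrt_mult real_sqrt_pow2 real_sqrt_abs abs_of_nat)
  finally show "sqrt (real (Suc j) * (real N - real j)) * sqrt (real (N choose j)) = real (Suc j) * sqrt (real (N choose Suc j))" .
  have "sqrt (real (Suc j) * (real N - real j)) * sqrt (real (N choose Suc j))
      = sqrt ((real N - real j) * (real (Suc j) * real (N choose Suc j)))"
    by (simp only: real_sqrt_mult[symmetric] mult_ac)
  also have "\<dots> = sqrt ((real N - real j)\<^sup>2 * real (N choose j))"
    unfolding b by (simp only: power2_eq_square mult.assoc)
  also have "\<dots> = (real N - real j) * sqrt (real (N choose j))"
    using assms by (simp add: real_sqrt_mult)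
  finally show "sqrt (real (Suc j) * (real N - real j)) * sqrt (real (N choose Suc j)) = (real N - real j) * sqrt (real (N choose j))" .
qed

text \<open>With p = i + 1 this is (n+1-2p)/2, the logarithm of the p-th eigenvalue of the Fuchsian
  holonomy per unit of length. The set of weights is symmetric about 0.\<close>

definition spin_weight :: "nat \<Rightarrow> nat \<Rightarrow> real" where
  "spin_weight n i = (real n - 1) / 2 - real i"

text \<open>The entries are sqrt(p(n-p))/2: this is the x-component of angular momentum in the
  irreducible representation of dimension n.\<close>

definition spin_mat :: "nat \<Rightarrow> complex mat" where
  "spin_mat n = mat n n (\<lambda>(i, j). if j = i + 1 then c_coeff n j / complex_of_real (sqrt 2)
     else if i = j + 1 then c_coeff n i / complex_of_real (sqrt 2) else 0)"

text \<open>Its rows are left eigenvectors of S, scaled so that column 0 is constantly 1 rather than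
  orthonormal. The columns of \<open>kraw_inv\<close> are the dual right eigenvectors; the 2^(n-1)
  there comes from the involution.\<close>

definition kraw_mat :: "nat \<Rightarrow> complex mat" where
  "kraw_mat n = mat n n (\<lambda>(i, j). complex_of_real (kraw (n - 1) i j / sqrt (real ((n - 1) choose j))))"

definition kraw_inv :: "nat \<Rightarrow> complex mat" where
  "kraw_inv n = mat n n (\<lambda>(i, j). complex_of_real (sqrt (real ((n - 1) choose i)) * kraw (n - 1) i j / 2 ^ (n - 1)))"

definition weight_mat :: "nat \<Rightarrow> complex mat" where
  "weight_mat n = mat n n (\<lambda>(i, j). if i = j then complex_of_real (spin_weight n i) else 0)"

definition weight_exp :: "nat \<Rightarrow> real \<Rightarrow> complex mat" where
  "weight_exp n s = mat n n (\<lambda>(i, j). if i = j then complex_of_real (exp (s * spin_weight n i)) else 0)"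

lemma spin_carrier [simp]:
  "spin_mat n \<in> carrier_mat n n" "kraw_mat n \<in> carrier_mat n n" "kraw_inv n \<in> carrier_mat n n"
  "weight_mat n \<in> carrier_mat n n" "weight_exp n s \<in> carrier_mat n n"
  by (simp_all add: spin_mat_def kraw_mat_def kraw_inv_def weight_mat_def weight_exp_def)

lemma mult_mat_entry:
  assumes "A \<in> carrier_mat n n" "B \<in> carrier_mat n n" "i < n" "j < n"
  shows "(A * B) $$ (i, j) = (\<Sum>k<n. A $$ (i, k) * B $$ (k, j))"
  using assms by (simp add: scalar_prod_def atLeast0LessThan)

lemma kraw_mat_inv:
  assumes "0 < n"
  shows "kraw_mat n * kraw_inv n = 1\<^sub>m n" "kraw_inv n * kraw_mat n = 1\<^sub>m n"
proof -
  have le: "{..<n} = {..n - 1}" using assms by auto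
  show "kraw_mat n * kraw_inv n = 1\<^sub>m n"
  proof (rule eq_matI)
    fix i j assume ij: "i < dim_row (1\<^sub>m n :: complex mat)" "j < dim_col (1\<^sub>m n :: complex mat)"
    then have "(kraw_mat n * kraw_inv n) $$ (i, j)
        = (\<Sum>k<n. complex_of_real (kraw (n - 1) i k * kraw (n - 1) k j / 2 ^ (n - 1)))"
      by (subst mult_mat_entry) (auto simp: kraw_mat_def kraw_inv_def intro!: sum.cong)
    also have "\<dots> = complex_of_real ((\<Sum>k\<le>n - 1. kraw (n - 1) i k * kraw (n - 1) k j) / 2 ^ (n - 1))"
      by (simp add: le sum_divide_distrib)
    also have "\<dots> = 1\<^sub>m n $$ (i, j)"
      using ij kraw_involution[of i "n - 1" j] by auto
    finally show "(kraw_mat n * kraw_inv n) $$ (i, j) = 1\<^sub>m n $$ (i, j)" .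
  qed (simp_all add: kraw_mat_def kraw_inv_def)
  show "kraw_inv n * kraw_mat n = 1\<^sub>m n"
  proof (rule eq_matI)
    fix i j assume ij: "i < dim_row (1\<^sub>m n :: complex mat)" "j < dim_col (1\<^sub>m n :: complex mat)"
    let ?b = "\<lambda>j. sqrt (real ((n - 1) choose j))"
    have "(kraw_inv n * kraw_mat n) $$ (i, j)
        = (\<Sum>k<n. complex_of_real (?b i / (2 ^ (n - 1) * ?b j) * (kraw (n - 1) i k * kraw (n - 1) k j)))"
      using ij by (subst mult_mat_entry) (auto simp: kraw_mat_def kraw_inv_def intro!: sum.cong)
    also have "\<dots> = complex_of_real (?b i / (2 ^ (n - 1) * ?b j) * (\<Sum>k\<le>n - 1. kraw (n - 1) i k * kraw (n - 1) k j))"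
      by (simp add: le sum_distrib_left)
    also have "\<dots> = 1\<^sub>m n $$ (i, j)"
      using ij kraw_involution[of i "n - 1" j] by auto
    finally show "(kraw_inv n * kraw_mat n) $$ (i, j) = 1\<^sub>m n $$ (i, j)" .
  qed (simp_all add: kraw_mat_def kraw_inv_def)
qed

text \<open>This is half the three-term recurrence after the rescaling by roots of binomials; the
  halving turns N - 2i into the weight N/2 - i.\<close>

lemma kraw_scaled_recurrence:
  assumes i: "i \<le> N" and j: "j \<le> N"
  defines "u \<equiv> \<lambda>k. kraw N i k / sqrt (real (N choose k))"
  shows "(if j = 0 then 0 else u (j - 1) * (sqrt (real j * (real N - (real j - 1))) / 2))
    + u (Suc j) * (sqrt (real (Suc j) * (real N - real j)) / 2) = (real N / 2 - real i) * u j"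
proof -
  have cross: "K / c * p = r * K / b" if "p * b = r * c" "0 < b" "0 < c" for K b c p r :: real
  proof -
    have "p = r * c / b" using that by (simp add: eq_divide_eq)
    then show ?thesis using that by simp
  qed
  have down: "u (Suc j) * sqrt (real (Suc j) * (real N - real j)) = real (Suc j) * kraw N i (Suc j) / sqrt (real (N choose j))"
  proof (cases "j = N")
    \<comment> \<open>At the upper end both sides vanish: the left by its factor N - j, the right
      because the generating polynomial has degree at most N.\<close>
    case True
    then show ?thesis using i by (simp add: kraw_beyond)
  next
    case False
    then have "j < N" using j by simp
    then have pos: "0 < sqrt (real (N choose j))" "0 < sqrt (real (N choose Suc j))"
      by (simp_all add: zero_less_binomial)
    show ?thesis
      unfolding u_def by (rule cross[OF sqrt_binomial_Suc(1)[OF \<open>j < N\<close>] pos])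
  qed
  have up: "u k * sqrt (real j * (real N - (real j - 1))) = (real N - (real j - 1)) * kraw N i k / sqrt (real (N choose j))"
    if k: "j = Suc k" for k
  proof -
    have "k < N" using j k by simp
    then have pos: "0 < sqrt (real (N choose k))" "0 < sqrt (real (N choose j))"
      using j by (simp_all add: zero_less_binomial)
    have shift: "real N - (real (Suc k) - 1) = real N - real k" by simp
    show ?thesis
      using pos unfolding u_def k shift
      by (intro cross[OF sqrt_binomial_Suc(2)[OF \<open>k < N\<close>]])
  qed
  have pos: "0 < sqrt (real (N choose j))" using j by (simp add: zero_less_binomial)
  show ?thesis
  proof (cases j)
    case 0
    then show ?thesis using kraw_recurrence[OF i, of j] down pos i
      by (simp add: u_def field_simps)
  next
    case (Suc k)
    have "u k * sqrt (real j * (real N - (real j - 1))) + u (Suc j) * sqrt (real (Suc j) * (real N - real j))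
      = ((real N - (real j - 1)) * kraw N i k + real (Suc j) * kraw N i (Suc j)) / sqrt (real (N choose j))"
      using up[OF Suc] down by (simp add: add_divide_distrib)
    also have "\<dots> = (real N - 2 * real i) * u j"
      using kraw_recurrence[OF i, of j] Suc by (simp add: u_def add.commute)
    finally show ?thesis using Suc by (simp add: field_simps)
  qed
qed

lemma c_coeff_div_sqrt2:
  "c_coeff n p / complex_of_real (sqrt 2) = complex_of_real (sqrt (real p * (real n - real p)) / 2)"
  by (simp add: c_coeff_def real_sqrt_divide flip: of_real_divide)

lemma kraw_diagonalises_spin:
  assumes "0 < n"
  shows "kraw_mat n * spin_mat n = weight_mat n * kraw_mat n"
proof (rule eq_matI)
  fix i j assume "i < dim_row (weight_mat n * kraw_mat n)" "j < dim_col (weight_mat n * kraw_mat n)"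
  then have ij: "i < n" "j < n" by (simp_all add: weight_mat_def kraw_mat_def)
  define N where "N = n - 1"
  have N: "n = Suc N" using assms by (simp add: N_def)
  define u where "u = (\<lambda>k. kraw N i k / sqrt (real (N choose k)))"
  have "(kraw_mat n * spin_mat n) $$ (i, j) = (\<Sum>k<n. complex_of_real (u k) * spin_mat n $$ (k, j))"
    using ij by (subst mult_mat_entry) (auto simp: kraw_mat_def u_def N_def)
  also have "\<dots> = (\<Sum>k<n. (if Suc k = j then complex_of_real (u k * (sqrt (real j * (real n - real j)) / 2)) else 0)
       + (if k = Suc j then complex_of_real (u k * (sqrt (real (Suc j) * (real n - real (Suc j))) / 2)) else 0))"
    using ij by (intro sum.cong refl) (auto simp: spin_mat_def c_coeff_div_sqrt2)
  also have "\<dots> = complex_of_real ((if j = 0 then 0 else u (j - 1) * (sqrt (real j * (real N - (real j - 1))) / 2))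
    + u (Suc j) * (sqrt (real (Suc j) * (real N - real j)) / 2))"
  proof -
    have "(\<Sum>k<n. if Suc k = j then complex_of_real (u k * (sqrt (real j * (real n - real j)) / 2)) else 0)
      = complex_of_real (if j = 0 then 0 else u (j - 1) * (sqrt (real j * (real N - (real j - 1))) / 2))"
      using ij by (cases j) (auto simp: N)
    \<comment> \<open>For \<open>Suc j\<close> = n no index contributes to the sum, while the right
      side vanishes through its factor N - j.\<close>
    moreover have "(\<Sum>k<n. if k = Suc j then complex_of_real (u k * (sqrt (real (Suc j) * (real n - real (Suc j))) / 2)) else 0)
      = complex_of_real (u (Suc j) * (sqrt (real (Suc j) * (real N - real j)) / 2))"
      using ij by (auto simp: N not_less_eq less_Suc_eq)
    ultimately show ?thesis by (simp only: sum.distrib of_real_add)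
  qed
  also have "\<dots> = complex_of_real ((real N / 2 - real i) * u j)"
    using kraw_scaled_recurrence[of i N j] ij unfolding u_def N by (simp only: less_Suc_eq_le)
  also have "\<dots> = (weight_mat n * kraw_mat n) $$ (i, j)"
  proof -
    have wi: "spin_weight n i = real N / 2 - real i" by (simp add: spin_weight_def N)
    have "(weight_mat n * kraw_mat n) $$ (i, j)
        = (\<Sum>k<n. if k = i then complex_of_real ((real N / 2 - real i) * u j) else 0)"
      unfolding mult_mat_entry[OF spin_carrier(4) spin_carrier(2) ij]
      by (intro sum.cong refl) (use ij wi in \<open>auto simp: weight_mat_def kraw_mat_def u_def N_def\<close>)
    then show ?thesis using ij by simp
  qed
  finally show "(kraw_mat n * spin_mat n) $$ (i, j) = (weight_mat n * kraw_mat n) $$ (i, j)" .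
qed (simp_all add: weight_mat_def kraw_mat_def spin_mat_def)

section \<open>Recovering the holonomy from its adjoint action\<close>

lemma G_transition_carrier [simp]: "G_transition n t M \<in> carrier_mat n n"
  by (simp add: G_transition_def)

lemma G_transition_index:
  "i < n \<Longrightarrow> j < n \<Longrightarrow> G_transition n t M $$ (i, j) = t powi (int i - int j) * M $$ (i, j)"
  by (simp add: G_transition_def)

text \<open>For nonzero t, \<open>G_transition\<close> is conjugation by the diagonal matrix with
  entries t^i. It is therefore an algebra automorphism that preserves the trace and fixes diagonal
  matrices.\<close>

lemma G_transition_mult:
  assumes "t \<noteq> 0" "A \<in> carrier_mat n n" "B \<in> carrier_mat n n"
  shows "G_transition n t A * G_transition n t B = G_transition n t (A * B)"
proof (rule eq_matI)
  fix i j assume "i < dim_row (G_transition n t (A * B))" "j < dim_col (G_transition n t (A * B))"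
  then have ij: "i < n" "j < n" by (simp_all add: G_transition_def)
  have "(G_transition n t A * G_transition n t B) $$ (i, j)
      = (\<Sum>k<n. t powi (int i - int j) * (A $$ (i, k) * B $$ (k, j)))"
    unfolding mult_mat_entry[OF G_transition_carrier G_transition_carrier ij]
  proof (intro sum.cong refl)
    fix k assume "k \<in> {..<n}"
    moreover have "t powi (int i - int j) = t powi (int i - int k) * t powi (int k - int j)"
      using assms(1) by (simp flip: power_int_add)
    ultimately show "G_transition n t A $$ (i, k) * G_transition n t B $$ (k, j)
        = t powi (int i - int j) * (A $$ (i, k) * B $$ (k, j))"
      using ij by (simp add: G_transition_index)
  qed
  then show "(G_transition n t A * G_transition n t B) $$ (i, j) = G_transition n t (A * B) $$ (i, j)"
    using ij by (simp only: G_transition_index mult_mat_entry[OF assms(2,3) ij] sum_distrib_left)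
qed (simp_all add: G_transition_def)

lemma G_transition_one [simp]: "G_transition n t (1\<^sub>m n) = 1\<^sub>m n"
  by (rule eq_matI) (auto simp: G_transition_def)

lemma G_transition_comp:
  "G_transition n s (G_transition n t M) = G_transition n (s * t) M"
  by (rule eq_matI) (auto simp: G_transition_def power_int_mult_distrib)

lemma G_transition_by_one: "M \<in> carrier_mat n n \<Longrightarrow> G_transition n 1 M = M"
  by (rule eq_matI) (auto simp: G_transition_def)

lemma G_transition_weight_exp [simp]: "G_transition n t (weight_exp n s) = weight_exp n s"
  by (rule eq_matI) (auto simp: G_transition_def weight_exp_def)

lemma mat_trace_carrier: "M \<in> carrier_mat n n \<Longrightarrow> mat_trace M = (\<Sum>i<n. M $$ (i, i))"
  by (simp add: mat_trace_def)

lemma mat_trace_G_transition [simp]: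
  "M \<in> carrier_mat n n \<Longrightarrow> mat_trace (G_transition n t M) = mat_trace M"
  by (simp add: mat_trace_carrier[of _ n] G_transition_index)

lemma mat_trace_add:
  "A \<in> carrier_mat n n \<Longrightarrow> B \<in> carrier_mat n n \<Longrightarrow> mat_trace (A + B) = mat_trace A + mat_trace B"
  by (simp add: mat_trace_def sum.distrib)

lemma mat_trace_diff:
  fixes A B :: "'b::comm_ring_1 mat"
  shows "A \<in> carrier_mat n n \<Longrightarrow> B \<in> carrier_mat n n \<Longrightarrow> mat_trace (A - B) = mat_trace A - mat_trace B"
  by (simp add: mat_trace_def sum_subtractf)

lemma mat_trace_mult_commute:
  fixes A B :: "'b::comm_ring_1 mat"
  assumes "A \<in> carrier_mat n n" "B \<in> carrier_mat n n"
  shows "mat_trace (A * B) = mat_trace (B * A)"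
proof -
  have "mat_trace (A * B) = (\<Sum>i<n. \<Sum>k<n. A $$ (i, k) * B $$ (k, i))"
    using assms by (simp add: mat_trace_carrier[of _ n] mult_mat_entry scalar_prod_def atLeast0LessThan)
  also have "\<dots> = (\<Sum>k<n. \<Sum>i<n. B $$ (k, i) * A $$ (i, k))"
    by (subst sum.swap) (simp add: mult.commute)
  also have "\<dots> = mat_trace (B * A)"
    using assms by (simp add: mat_trace_carrier[of _ n] scalar_prod_def atLeast0LessThan)
  finally show ?thesis .
qed

lemma weight_exp_mult: "weight_exp n s * weight_exp n t = weight_exp n (s + t)"
proof (rule eq_matI)
  fix i j assume "i < dim_row (weight_exp n (s + t))" "j < dim_col (weight_exp n (s + t))"
  then have ij: "i < n" "j < n" by (simp_all add: weight_exp_def)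
  have "(weight_exp n s * weight_exp n t) $$ (i, j)
      = (\<Sum>k<n. if k = i then weight_exp n (s + t) $$ (i, j) else 0)"
    unfolding mult_mat_entry[OF spin_carrier(5) spin_carrier(5) ij]
    by (intro sum.cong refl) (use ij in \<open>auto simp: weight_exp_def ring_distribs exp_add\<close>)
  then show "(weight_exp n s * weight_exp n t) $$ (i, j) = weight_exp n (s + t) $$ (i, j)"
    using ij by simp
qed (simp_all add: weight_exp_def)

lemma weight_exp_0 [simp]: "weight_exp n 0 = 1\<^sub>m n"
  by (rule eq_matI) (auto simp: weight_exp_def)

text \<open>This gives the exponential of the weights determinant 1, so that a scalar relating it to
  another matrix of determinant 1 is an n-th root of unity.\<close>

lemma sum_spin_weight: "(\<Sum>i<n. spin_weight n i) = 0"
proof -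
  have "(\<Sum>i<m. real i) = real m * (real m - 1) / 2" for m
    by (induction m) (auto simp: field_simps)
  then show ?thesis by (simp add: spin_weight_def sum_subtractf algebra_simps)
qed

lemma det_weight_exp: "Determinant.det (weight_exp n s) = 1"
proof -
  have "Determinant.det (weight_exp n s) = prod_list (diag_mat (weight_exp n s))"
    by (rule det_upper_triangular[of _ n]) (auto simp: weight_exp_def upper_triangular_def)
  also have "\<dots> = (\<Prod>i<n. complex_of_real (exp (s * spin_weight n i)))"
    by (simp add: diag_mat_def prod.list_conv_set_nth weight_exp_def atLeast0LessThan)
  also have "\<dots> = complex_of_real (exp (s * (\<Sum>i<n. spin_weight n i)))"
    by (simp add: sum_distrib_left exp_sum)
  finally show ?thesis by (simp add: sum_spin_weight)
qed

text \<open>A form of Schur's lemma by direct test: off-diagonal elementary matrices are traceless,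
  and commuting with them already makes the diagonal constant and the other entries 0.\<close>

lemma commutes_with_traceless_imp_scalar:
  fixes M :: "complex mat"
  assumes M: "M \<in> carrier_mat n n" and n: "0 < n"
    and comm: "\<And>Y. Y \<in> carrier_mat n n \<Longrightarrow> mat_trace Y = 0 \<Longrightarrow> Y * M = M * Y"
  obtains k where "M = k \<cdot>\<^sub>m 1\<^sub>m n"
proof -
  have unit: "(if i' = i then M $$ (j, j') else 0) = (if j' = j then M $$ (i', i) else 0)"
    if ij: "i < n" "j < n" "i \<noteq> j" "i' < n" "j' < n" for i j i' j'
  proof -
    define Y :: "complex mat" where "Y = mat n n (\<lambda>(a, b). if a = i \<and> b = j then 1 else 0)"
    have Y: "Y \<in> carrier_mat n n" by (simp add: Y_def)
    have "mat_trace Y = 0"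
      using ij by (simp add: mat_trace_carrier[OF Y]) (auto simp: Y_def intro!: sum.neutral)
    then have "(Y * M) $$ (i', j') = (M * Y) $$ (i', j')" using comm[OF Y] by simp
    moreover have "(Y * M) $$ (i', j') = (\<Sum>k<n. if k = j then (if i' = i then M $$ (j, j') else 0) else 0)"
      unfolding mult_mat_entry[OF Y M ij(4,5)]
      by (intro sum.cong refl) (use ij in \<open>auto simp: Y_def\<close>)
    moreover have "(M * Y) $$ (i', j') = (\<Sum>k<n. if k = i then (if j' = j then M $$ (i', i) else 0) else 0)"
      unfolding mult_mat_entry[OF M Y ij(4,5)]
      by (intro sum.cong refl) (use ij in \<open>auto simp: Y_def\<close>)
    ultimately show ?thesis using ij by simp
  qed
  have "M = M $$ (0, 0) \<cdot>\<^sub>m 1\<^sub>m n"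
  proof (rule eq_matI)
    fix i j assume "i < dim_row (M $$ (0, 0) \<cdot>\<^sub>m 1\<^sub>m n)" "j < dim_col (M $$ (0, 0) \<cdot>\<^sub>m 1\<^sub>m n)"
    then have ij: "i < n" "j < n" by auto
    show "M $$ (i, j) = (M $$ (0, 0) \<cdot>\<^sub>m 1\<^sub>m n) $$ (i, j)"
    proof (cases "i = j")
      case True
      \<comment> \<open>The elementary matrix at (i, 0), compared at the entry (i, 0), equates the
        diagonal entries of index 0 and i.\<close>
      then show ?thesis using unit[of i 0 i 0] ij n by (cases "i = 0") auto
    next
      case False
      \<comment> \<open>The elementary matrix at (j, i), compared at the entry (j, j), isolates the
        entry (i, j) of M on one side and gives 0 on the other.\<close>
      then show ?thesis using unit[of j i j j] ij by auto
    qed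
  qed (use M in auto)
  then show ?thesis using that by blast
qed

text \<open>To be read with e a positive eigenvalue of the expected holonomy and k the undetermined
  scalar, so that k e is an eigenvalue of the actual one.\<close>

lemma real_pos_root_of_unity:
  assumes "k * complex_of_real e \<in> \<real>" "Re (k * complex_of_real e) > 0" "0 < e" "k ^ n = 1" "0 < n"
  shows "k = 1"
proof -
  have "k = (k * complex_of_real e) / complex_of_real e" using assms(3) by simp
  also have "\<dots> \<in> \<real>" using assms(1) by (intro Reals_divide Reals_of_real)
  finally have "k \<in> \<real>" .
  then obtain r where r: "k = complex_of_real r" by (auto elim: Reals_cases)
  have "r > 0" using assms(2,3) by (simp add: r zero_less_mult_iff)
  moreover have "r ^ n = 1" using assms(4) by (simp add: r flip: of_real_power)
  ultimately have "r = 1" using assms(5) by (metis less_imp_le power_eq_1_iff abs_of_nonneg real_norm_def neq0_conv)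
  then show ?thesis using r by simp
qed

text \<open>By Schur the two sides agree up to a scalar; the determinant makes it a root of unity and the
  positivity of the eigenvalues makes it 1.\<close>

lemma holonomy_from_adjoint:
  fixes T :: "complex mat"
  assumes n: "0 < n" and T: "T \<in> carrier_mat n n" and det: "Determinant.det T = 1"
    and pos: "\<And>k. eigenvalue T k \<Longrightarrow> k \<in> \<real> \<and> Re k > 0"
    and Z: "inverse_mats n Zi Z"
    and adj: "\<And>Y. Y \<in> carrier_mat n n \<Longrightarrow> mat_trace Y = 0 \<Longrightarrow>
       (Zi * (weight_exp n s * Y * weight_exp n (- s)) * Z) * T = T * (Zi * Y * Z)"
  shows "T = Zi * weight_exp n s * Z"
proof -
  have [simp]: "Z \<in> carrier_mat n n" "Zi \<in> carrier_mat n n" and ZZ: "Z * Zi = 1\<^sub>m n" "Zi * Z = 1\<^sub>m n"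
    using Z by (auto simp: inverse_mats_def)
  note [simp] = T
  let ?E = "weight_exp n s" and ?F = "weight_exp n (- s)"
  have EF: "?E * ?F = 1\<^sub>m n" "?F * ?E = 1\<^sub>m n" by (simp_all add: weight_exp_mult)
  note assoc = assoc_mult_mat[of _ n n _ n _ n]
  have cancel: "Z * (Zi * X) = X" "Zi * (Z * X) = X" "?E * (?F * X) = X" "?F * (?E * X) = X"
    if "X \<in> carrier_mat n n" for X
    using that ZZ EF by (metis assoc left_mult_one_mat spin_carrier(5) \<open>Z \<in> carrier_mat n n\<close> \<open>Zi \<in> carrier_mat n n\<close>)+
  \<comment> \<open>M compares T with the expected holonomy in the eigenbasis; transported there,
    \<open>adj\<close> says exactly that M commutes with every traceless Y.\<close>
  define M where "M = ?F * (Z * (T * Zi))"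
  have M: "M \<in> carrier_mat n n" by (simp add: M_def mult_carrier_mat[of _ n n _ n])
  note c = mult_carrier_mat[of _ n n _ n]
  have "Y * M = M * Y" if Y: "Y \<in> carrier_mat n n" "mat_trace Y = 0" for Y
  proof -
    have "?F * (Z * (((Zi * (?E * Y * ?F) * Z) * T) * Zi)) = ?F * (Z * ((T * (Zi * Y * Z)) * Zi))"
      using adj[OF Y] by simp
    then show ?thesis using Y ZZ by (simp add: M_def assoc cancel c)
  qed
  then obtain k where k: "M = k \<cdot>\<^sub>m 1\<^sub>m n"
    using commutes_with_traceless_imp_scalar[OF M n] by blast
  have "T = Zi * (?E * (M * Z))"
    using ZZ by (simp add: M_def assoc cancel c right_mult_one_mat[of _ n n])
  also have "\<dots> = k \<cdot>\<^sub>m (Zi * ?E * Z)"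
    by (simp add: k assoc c left_mult_one_mat[of _ n n] mult_smult_assoc_mat[of _ n n _ n] mult_smult_distrib[of _ n n _ n])
  finally have Tk: "T = k \<cdot>\<^sub>m (Zi * ?E * Z)" .
  have "Determinant.det Zi * Determinant.det Z = 1"
    using ZZ det_mult[of Zi n Z] by simp
  then have "k ^ n = 1"
    using det carrier_matD(2)[of Z n n] by (simp add: Tk det_mult[of _ n] c det_weight_exp det_smult)
  \<comment> \<open>One eigenvalue is enough to decide reality and sign of k. Column 0 of
    \<open>Zi\<close> is an eigenvector of \<open>Zi * ?E * Z\<close>, hence of its multiple
    T.\<close>
  moreover have "eigenvalue T (k * complex_of_real (exp (s * spin_weight n 0)))"
    unfolding eigenvalue_def
  proof (intro exI[of _ "col Zi 0"])
    let ?e = "complex_of_real (exp (s * spin_weight n 0))"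
    have "T * Zi = k \<cdot>\<^sub>m (Zi * ?E)"
      using ZZ by (simp add: Tk assoc c right_mult_one_mat[of _ n n] mult_smult_assoc_mat[of _ n n _ n])
    moreover have "col (T * Zi) 0 = T *\<^sub>v col Zi 0"
      using n by (intro col_mult2[of _ n n _ n]) auto
    moreover have "col (k \<cdot>\<^sub>m (Zi * ?E)) 0 = (k * ?e) \<cdot>\<^sub>v col Zi 0"
    proof (rule eq_vecI)
      fix i assume "i < dim_vec ((k * ?e) \<cdot>\<^sub>v col Zi 0)"
      then have i: "i < n" using carrier_matD[of Zi n n] by simp
      have "(Zi * ?E) $$ (i, 0) = (\<Sum>j<n. if j = 0 then Zi $$ (i, 0) * ?e else 0)"
        unfolding mult_mat_entry[OF \<open>Zi \<in> carrier_mat n n\<close> spin_carrier(5) i n]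
        by (intro sum.cong refl) (use n in \<open>auto simp: weight_exp_def\<close>)
      then show "col (k \<cdot>\<^sub>m (Zi * ?E)) 0 $ i = ((k * ?e) \<cdot>\<^sub>v col Zi 0) $ i"
        using n i carrier_matD[of Zi n n] carrier_matD[OF spin_carrier(5)[of n s]] by simp
    qed (use n carrier_matD[of Zi n n] in simp)
    moreover have "col Zi 0 \<noteq> 0\<^sub>v n"
    proof
      assume "col Zi 0 = 0\<^sub>v n"
      then have "Z *\<^sub>v col Zi 0 = 0\<^sub>v n"
        using carrier_matD[of Z n n] by (intro eq_vecI) auto
      then have "col (Z * Zi) 0 = 0\<^sub>v n"
        using n by (subst col_mult2[of _ n n _ n]) auto
      then have "col (1\<^sub>m n :: complex mat) 0 $ 0 = 0" using ZZ n by simp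
      then show False using n by simp
    qed
    ultimately show "eigenvector T (col Zi 0) (k * ?e)"
      using n carrier_matD[OF T] by (simp add: eigenvector_def)
  qed
  ultimately have "k = 1"
    using pos n by (intro real_pos_root_of_unity[of k "exp (s * spin_weight n 0)" n]) (blast, blast, simp_all)
  moreover have "1 \<cdot>\<^sub>m (Zi * ?E * Z) = Zi * ?E * Z" by (rule eq_matI) simp_all
  ultimately show ?thesis using Tk by simp
qed

section \<open>The Higgs field and the deformation in a unit frame\<close>

text \<open>Each factor -sqrt 2 X_n sends the p-th basis vector to sqrt(p(n-p)) times the next one,
  the sqrt 2 cancelling the half in \<open>c_coeff\<close>. A power multiplies these numbers along
  the chain.\<close>

lemma E0_mat_index:
  assumes "i < n" "j < n"
  shows "E0_mat n k $$ (i, j)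
    = (if i = j + k then complex_of_real (\<Prod>l<k. sqrt (real (Suc (j + l)) * (real n - real (Suc (j + l))))) else 0)"
  using assms
proof (induction k arbitrary: i j)
  case 0
  then show ?case by (auto simp: E0_mat_def X_mat_def)
next
  case (Suc k)
  define G where "G = complex_of_real (- sqrt 2) \<cdot>\<^sub>m X_mat n"
  define g where "g j = sqrt (real (Suc j) * (real n - real (Suc j)))" for j
  have G: "G \<in> carrier_mat n n" by (simp add: G_def X_mat_def)
  have Gk: "E0_mat n k \<in> carrier_mat n n"
    using pow_carrier_mat[OF G] by (simp add: E0_mat_def G_def)
  have G_index: "G $$ (m, j) = (if m = Suc j then complex_of_real (g j) else 0)" if "m < n" for m
  proof -
    have "sqrt 2 * sqrt (x / 2) = sqrt x" for x by (simp add: real_sqrt_divide)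
    then show ?thesis
      using that Suc.prems by (auto simp: G_def X_mat_def c_coeff_def g_def simp flip: of_real_mult)
  qed
  have "E0_mat n (Suc k) $$ (i, j) = (E0_mat n k * G) $$ (i, j)"
    by (simp add: E0_mat_def G_def)
  also have "\<dots> = (\<Sum>m<n. if m = Suc j then E0_mat n k $$ (i, m) * complex_of_real (g j) else 0)"
    unfolding mult_mat_entry[OF Gk G Suc.prems]
    by (intro sum.cong refl) (simp add: G_index)
  also have "\<dots> = (if Suc j < n then E0_mat n k $$ (i, Suc j) * complex_of_real (g j) else 0)"
    by simp
  \<comment> \<open>The additional factor stands on the right and acts first, so the product is
    split off at l = 0 and the remaining indices shift.\<close>
  also have "\<dots> = (if i = j + Suc k then complex_of_real (\<Prod>l<Suc k. g (j + l)) else 0)"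
    using Suc by (subst prod.lessThan_Suc_shift) (auto simp: g_def)
  finally show ?case by (simp only: g_def)
qed

text \<open>The numbers l+1 and N-l run through 1, ..., N in opposite orders, so the product under
  the roots is the square of N!. This is the source of (n-1)! in the formula.\<close>

lemma prod_sqrt_fact: "(\<Prod>l<N. sqrt (real (Suc l) * (real N - real l))) = fact N"
proof -
  have "(\<Prod>l<N. sqrt (real (Suc l) * (real N - real l)))
      = (\<Prod>l<N. sqrt (real (Suc l))) * (\<Prod>l<N. sqrt (real (Suc (N - Suc l))))"
    by (subst prod.distrib[symmetric], intro prod.cong refl) (simp add: real_sqrt_mult of_nat_diff)
  also have "(\<Prod>l<N. sqrt (real (Suc (N - Suc l)))) = (\<Prod>l<N. sqrt (real (Suc l)))"
    by (rule prod.nat_diff_reindex)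
  also have "(\<Prod>l<N. sqrt (real (Suc l))) * (\<Prod>l<N. sqrt (real (Suc l))) = (\<Prod>l<N. real (Suc l))"
    by (subst prod.distrib[symmetric], intro prod.cong refl) simp
  also have "\<dots> = fact N"
    by (simp add: fact_prod_Suc atLeast0LessThan)
  finally show ?thesis .
qed

lemma E0_mat_top:
  assumes "i < n" "j < n"
  shows "E0_mat n (n - 1) $$ (i, j) = (if i = n - 1 \<and> j = 0 then fact (n - 1) else 0)"
proof -
  have shift: "real n - real (Suc l) = real (n - 1) - real l" for l
    using assms by (simp add: of_nat_diff)
  show ?thesis
  proof (cases "i = j + (n - 1)")
    case True
    then have "j = 0" "i = n - 1" using assms by linarith+
    then show ?thesis
      unfolding E0_mat_index[OF assms] by (simp only: add_0 shift prod_sqrt_fact) simp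
  next
    case False
    then show ?thesis unfolding E0_mat_index[OF assms] by auto
  qed
qed

text \<open>The shape of psi^0 in a unit frame: there -\<rho> is the conjugate transpose, so the
  form is hermitian, and the top power of X_n leaves only the two ends of the antidiagonal.\<close>

definition corner_mat :: "nat \<Rightarrow> complex \<Rightarrow> complex mat" where
  "corner_mat n f = mat n n (\<lambda>(i, j). if i = n - 1 \<and> j = 0 then f
     else if i = 0 \<and> j = n - 1 then cnj f else 0)"

lemma corner_mat_carrier [simp]: "corner_mat n f \<in> carrier_mat n n"
  by (simp add: corner_mat_def)

lemma spin_mat_index:
  "i < n \<Longrightarrow> j < n \<Longrightarrow> spin_mat n $$ (i, j) = (if j = i + 1 then c_coeff n j / complex_of_real (sqrt 2)
     else if i = j + 1 then c_coeff n i / complex_of_real (sqrt 2) else 0)"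
  by (simp add: spin_mat_def)

lemma Phi0_index:
  "i < n \<Longrightarrow> j < n \<Longrightarrow> Phi0 n v $$ (i, j) = (if j = i + 1 then v * c_coeff n j else 0)"
  by (simp add: Phi0_def Y_mat_def)

lemma cartan_inv_index:
  "i < n \<Longrightarrow> j < n \<Longrightarrow>
    cartan_inv n hh M $$ (i, j) = - cnj (M $$ (j, i)) * complex_of_real (hh powi (int i - int j))"
  by (simp add: cartan_inv_def)

lemma form_carrier [simp]:
  "Phi0 n v \<in> carrier_mat n n" "cartan_inv n hh M \<in> carrier_mat n n"
  by (simp_all add: Phi0_def Y_mat_def cartan_inv_def)

text \<open>Unit speed trades the antiholomorphic factor produced by the Cartan involution for a
  power of v, so that the terms of opposite weight can be written with a single transition
  parameter.\<close>

lemma unit_vector_conj: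
  assumes "2 * hh * (cmod v)\<^sup>2 = 1"
  shows "v \<noteq> 0" "cnj v * complex_of_real hh = inverse (2 * v)"
proof -
  show v: "v \<noteq> 0" using assms by auto
  have "2 * v * (cnj v * complex_of_real hh) = 2 * complex_of_real hh * (v * cnj v)"
    by (simp only: mult_ac)
  also have "\<dots> = complex_of_real (2 * hh * (cmod v)\<^sup>2)"
    unfolding complex_norm_square[symmetric] by simp
  also have "\<dots> = 1" unfolding assms by simp
  finally show "cnj v * complex_of_real hh = inverse (2 * v)"
    by (rule inverse_unique[symmetric])
qed

text \<open>The entries are v c_p at weight -1 and cnj v h c_p = c_p/(2v) at weight 1. With t =
  1/(sqrt 2 v) both are t^m times the same number c_p / sqrt 2, which is why sqrt 2 times the
  velocity is the right frame. L is the speed of the reparametrised curve.\<close>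

lemma Higgs_form_frame:
  assumes unit: "2 * hh * (cmod v)\<^sup>2 = 1"
  shows "Phi0 n (complex_of_real L * v) - cartan_inv n hh (Phi0 n (complex_of_real L * v))
    = complex_of_real L \<cdot>\<^sub>m G_transition n (inverse (complex_of_real (sqrt 2) * v)) (spin_mat n)"
    (is "?A = ?B")
proof (rule eq_matI)
  fix i j assume "i < dim_row ?B" "j < dim_col ?B"
  then have ij: "i < n" "j < n" by (simp_all add: G_transition_def)
  note v = unit_vector_conj[OF unit]
  have index: "?A $$ (i, j) = Phi0 n (complex_of_real L * v) $$ (i, j)
      - cartan_inv n hh (Phi0 n (complex_of_real L * v)) $$ (i, j)"
    "?B $$ (i, j) = complex_of_real L
      * G_transition n (inverse (complex_of_real (sqrt 2) * v)) (spin_mat n) $$ (i, j)"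
    using ij carrier_matD[OF form_carrier(2)[of n]] by (simp_all add: G_transition_def)
  have s2: "complex_of_real (sqrt 2) * complex_of_real (sqrt 2) = 2"
    by (simp flip: of_real_mult)
  have cnj_c: "cnj (c_coeff n p) = c_coeff n p" for p by (simp add: c_coeff_def)
  consider "j = Suc i" | "i = Suc j" | "j \<noteq> Suc i" "i \<noteq> Suc j" by blast
  then show "?A $$ (i, j) = ?B $$ (i, j)"
  proof cases
    case 1
    then have "int i - int j = -1" by simp
    then show ?thesis using ij v(1) 1 unfolding index
      by (simp add: Phi0_index cartan_inv_index G_transition_index spin_mat_index power_int_minus)
  next
    case 2
    then have "int i - int j = 1" by simp
    then have "?A $$ (i, j) = complex_of_real L * c_coeff n i * (cnj v * complex_of_real hh)"
      using ij 2 unfolding index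
      by (simp add: Phi0_index cartan_inv_index cnj_c)
    moreover have "?B $$ (i, j) = complex_of_real L * c_coeff n i * inverse (2 * v)"
    proof -
      have "?B $$ (i, j) = complex_of_real L * (inverse (complex_of_real (sqrt 2) * v)
          * (c_coeff n i / complex_of_real (sqrt 2)))"
        using ij 2 \<open>int i - int j = 1\<close> unfolding index G_transition_index[OF ij]
        by (simp only: spin_mat_index) simp
      also have "\<dots> = complex_of_real L * c_coeff n i
          * inverse ((complex_of_real (sqrt 2) * complex_of_real (sqrt 2)) * v)"
        by (simp only: divide_inverse inverse_mult_distrib mult_ac)
      finally show ?thesis unfolding s2 .
    qed
    ultimately show ?thesis unfolding v(2) by (rule trans[OF _ sym])
  next
    case 3
    then show ?thesis using ij unfolding index
      by (simp add: Phi0_index cartan_inv_index G_transition_index spin_mat_index)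
  qed
qed (use carrier_matD[OF form_carrier(2)[of n]] in \<open>simp_all add: G_transition_def\<close>)

text \<open>Taking out t^(n-1) with t = 1/(sqrt 2 v) from the coefficient of weight n-1 costs the
  factor (sqrt 2 v)^(n-1). Its power of v completes v to v^n; its power of sqrt 2 is the one
  contained in \<open>Re_differential_density\<close>.\<close>

lemma psi0_frame:
  assumes n: "n \<ge> 2" and unit: "2 * h c z * (cmod v)\<^sup>2 = 1"
  shows "psi0 n h n q c z (complex_of_real L * v)
    = complex_of_real L \<cdot>\<^sub>m G_transition n (inverse (complex_of_real (sqrt 2) * v))
        (corner_mat n (fact (n - 1) * complex_of_real (sqrt 2) ^ (n - 1) * (q c z * v ^ n)))"
    (is "?A = ?B")
proof (rule eq_matI)
  fix i j assume "i < dim_row ?B" "j < dim_col ?B"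
  then have ij: "i < n" "j < n" by (simp_all add: G_transition_def)
  note v = unit_vector_conj[OF unit]
  let ?r = "complex_of_real (sqrt 2)"
  have s2: "?r * ?r = 2" by (simp flip: of_real_mult)
  have E0: "E0_mat n (n - 1) \<in> carrier_mat n n"
    by (simp add: E0_mat_def X_mat_def pow_carrier_mat)
  have vn: "v ^ n = v * v ^ (n - 1)" using n by (cases n) auto
  have phi: "phi0 n n q c z w $$ (a, b) = (if a = n - 1 \<and> b = 0 then q c z * w * fact (n - 1) else 0)"
    if "a < n" "b < n" for a b w
    using that carrier_matD[OF E0] E0_mat_top[OF that] by (simp add: phi0_def)
  have index: "?A $$ (i, j) = phi0 n n q c z (complex_of_real L * v) $$ (i, j)
      - cartan_inv n (h c z) (phi0 n n q c z (complex_of_real L * v)) $$ (i, j)"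
    using ij carrier_matD[OF form_carrier(2)[of n]] by (simp add: psi0_def)
  have index': "?B $$ (i, j) = complex_of_real L * (inverse (?r * v) powi (int i - int j) *
      corner_mat n (fact (n - 1) * ?r ^ (n - 1) * (q c z * v ^ n)) $$ (i, j))"
    using ij by (simp add: G_transition_def)
  have corner: "corner_mat n f $$ (n - 1, 0) = f" "corner_mat n f $$ (0, n - 1) = cnj f" for f
    using n by (simp_all add: corner_mat_def)
  have inv_r: "inverse (?r * v) powi - int m = (?r * v) ^ m" for m
    by (simp add: power_int_minus power_inverse del: inverse_mult_distrib)
  consider "i = n - 1" "j = 0" | "i = 0" "j = n - 1" | "\<not> (i = n - 1 \<and> j = 0)" "\<not> (i = 0 \<and> j = n - 1)"
    by blast
  then show "?A $$ (i, j) = ?B $$ (i, j)"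
  proof cases
    case 1
    then have ji: "int i - int j = int (n - 1)" by simp
    have lhs: "?A $$ (i, j) = q c z * (complex_of_real L * v) * fact (n - 1)"
      using 1 n phi[OF ij] phi[OF ij(2,1)] unfolding index cartan_inv_index[OF ij] by simp
    have "?B $$ (i, j) = complex_of_real L * (inverse (?r * v) ^ (n - 1) *
        (fact (n - 1) * ?r ^ (n - 1) * (q c z * v ^ n)))"
      unfolding index' ji power_int_of_nat unfolding 1 corner(1) ..
    also have "\<dots> = complex_of_real L * fact (n - 1) * q c z * v
        * (inverse (?r * v) ^ (n - 1) * (?r * v) ^ (n - 1))"
      by (simp only: vn mult_ac power_mult_distrib)
    also have "inverse (?r * v) ^ (n - 1) * (?r * v) ^ (n - 1) = 1"
      using v(1) by (subst power_mult_distrib[symmetric], subst left_inverse) simp_all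
    finally show ?thesis unfolding lhs by (simp only: mult_ac mult_1_left mult_1_right)
  next
    case 2
    then have ji: "int i - int j = - int (n - 1)" by (simp only: of_nat_0 diff_0)
    have lhs: "?A $$ (i, j) = cnj (q c z * (complex_of_real L * v)) * fact (n - 1) * inverse (complex_of_real (h c z) ^ (n - 1))"
      using 2 n phi[OF ij] phi[OF ij(2,1)]
      unfolding index cartan_inv_index[OF ij] ji power_int_minus power_int_of_nat by simp
    have cvn: "cnj v ^ n = cnj v * cnj v ^ (n - 1)" using n by (cases n) auto
    \<comment> \<open>This says that sqrt 2 v has norm 1 in the hermitian metric, so the powers of h
      from the Cartan involution become powers of v and its conjugate.\<close>
    have "complex_of_real (h c z) * ((?r * v) * (?r * cnj v)) = (?r * ?r) * (v * (cnj v * complex_of_real (h c z)))"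
      by (simp only: mult_ac)
    also have "\<dots> = 1" unfolding v(2) s2 using v(1) by simp
    finally have rr: "(?r * v) * (?r * cnj v) = inverse (complex_of_real (h c z))"
      by (rule inverse_unique[symmetric])
    have "?B $$ (i, j) = complex_of_real L * ((?r * v) ^ (n - 1) *
        (fact (n - 1) * ?r ^ (n - 1) * (cnj (q c z) * cnj v ^ n)))"
      unfolding index' ji inv_r unfolding 2 corner(2) by (simp only: complex_cnj_mult complex_cnj_power) simp
    also have "\<dots> = complex_of_real L * fact (n - 1) * cnj (q c z) * cnj v * ((?r * v) * (?r * cnj v)) ^ (n - 1)"
      unfolding cvn by (simp only: mult_ac power_mult_distrib)
    also have "\<dots> = complex_of_real L * fact (n - 1) * cnj (q c z) * cnj v * inverse (complex_of_real (h c z) ^ (n - 1))"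
      unfolding rr by (simp only: power_inverse)
    finally show ?thesis
      unfolding lhs by (simp only: complex_cnj_mult complex_cnj_complex_of_real mult_ac)
  next
    case 3
    then show ?thesis using ij
      unfolding index index' cartan_inv_index[OF ij] by (auto simp: phi corner_mat_def)
  qed
qed (use carrier_matD[OF form_carrier(2)[of n]] in \<open>simp_all add: psi0_def G_transition_def\<close>)

section \<open>Closed geodesics\<close>

lemma chart_overlap_open:
  assumes "is_chart c" "open V"
  shows "open (snd c ` (fst c \<inter> V))"
proof -
  from assms obtain g where o: "open (snd c ` fst c)"
    and g: "homeomorphism (fst c) (snd c ` fst c) (snd c) g"
    unfolding is_chart_def by blast
  have "openin (top_of_set (snd c ` fst c)) (snd c ` (fst c \<inter> V))"
    using assms(2) by (intro homeomorphism_imp_open_map[OF g] openin_open_Int)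
  then show ?thesis using o openin_open_trans by blast
qed

lemma chart_inj:
  assumes "is_chart c"
  shows "inj_on (snd c) (fst c)"
proof -
  from assms obtain g where "homeomorphism (fst c) (snd c ` fst c) (snd c) g"
    unfolding is_chart_def by blast
  then show ?thesis by (intro inj_on_inverseI[of _ g]) (simp add: homeomorphism_def)
qed

lemma has_vector_derivative_eventually_eq:
  assumes "(f has_vector_derivative D) (at x)" "eventually (\<lambda>y. f y = g y) (nhds x)"
  shows "(g has_vector_derivative D) (at x)"
  using assms(1) has_vector_derivative_cong_ev[of UNIV f g x D] assms(2) eventually_nhds_x_imp_x[OF assms(2)]
  by simp

text \<open>The image of the overlap is open, so holomorphy there makes \<open>deriv\<close>, as
  used in all transition rules, a true derivative at the point.\<close>

lemma coord_change_has_derivative: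
  assumes "complex_atlas \<A>" "c \<in> \<A>" "d \<in> \<A>" "x \<in> fst c" "x \<in> fst d"
  shows "(coord_change c d has_field_derivative deriv (coord_change c d) (snd c x)) (at (snd c x))"
proof -
  have "is_chart c" "is_chart d" using assms by (auto simp: complex_atlas_def)
  then have "open (snd c ` (fst c \<inter> fst d))"
    by (intro chart_overlap_open) (auto simp: is_chart_def)
  moreover have "coord_change c d holomorphic_on snd c ` (fst c \<inter> fst d)"
    using assms by (auto simp: complex_atlas_def)
  ultimately show ?thesis
    using assms(4,5) by (intro holomorphic_derivI) auto
qed

locale unit_speed_geodesic =
  fixes \<A> :: "'a::t2_space chart set" and h :: "'a chart \<Rightarrow> complex \<Rightarrow> real"
    and \<gamma> :: "real \<Rightarrow> 'a" and len :: real
  assumes atlas: "complex_atlas \<A>" and geodesic: "closed_geodesic \<A> h \<gamma> len"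
begin

abbreviation "V c s \<equiv> velocity c \<gamma> s"

lemma len_pos: "0 < len" and continuous_\<gamma>: "continuous_on UNIV \<gamma>" and periodic: "\<gamma> (s + len) = \<gamma> s"
  using geodesic by (auto simp: closed_geodesic_def)

lemma chart: "c \<in> \<A> \<Longrightarrow> is_chart c"
  using atlas by (auto simp: complex_atlas_def)

lemma exists_chart: obtains c where "c \<in> \<A>" "x \<in> fst c"
proof -
  have "x \<in> (\<Union>c\<in>\<A>. fst c)" using atlas by (simp add: complex_atlas_def)
  then show ?thesis using that by blast
qed

lemma eventually_in_chart:
  assumes "c \<in> \<A>" "\<gamma> s \<in> fst c"
  shows "eventually (\<lambda>r. \<gamma> r \<in> fst c) (nhds s)"
proof -
  have "open (\<gamma> -` fst c)"
    using continuous_\<gamma> chart[OF assms(1)] by (auto simp: is_chart_def intro: open_vimage)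
  then show ?thesis using assms(2) by (auto simp: eventually_nhds)
qed

context
  fixes c s assumes c: "c \<in> \<A>" "\<gamma> s \<in> fst c"
begin

lemma has_velocity: "((snd c \<circ> \<gamma>) has_vector_derivative V c s) (at s)"
  using geodesic c unfolding closed_geodesic_def velocity_def
  by (simp add: vector_derivative_works)

lemma unit_velocity: "2 * h c (snd c (\<gamma> s)) * (cmod (V c s))\<^sup>2 = 1"
  using geodesic c unfolding closed_geodesic_def by blast

lemma velocity_nonzero: "V c s \<noteq> 0"
  using unit_velocity by auto

lemma geodesic_equation:
  "(velocity c \<gamma> has_vector_derivative
     - del_z (\<lambda>w. ln (h c w)) (snd c (\<gamma> s)) * (V c s)\<^sup>2) (at s)"
  using geodesic c unfolding closed_geodesic_def by blast

lemma velocity_continuous: "isCont (velocity c \<gamma>) s"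
  using geodesic_equation has_vector_derivative_continuous by blast

lemma velocity_periodic: "V c (s + len) = V c s"
proof -
  have "((\<lambda>r. r - len) has_vector_derivative 1) (at (s + len))"
    by (auto intro!: derivative_eq_intros)
  moreover have "((snd c \<circ> \<gamma>) has_vector_derivative V c s) (at (s + len - len))"
    using has_velocity by simp
  ultimately have "(((snd c \<circ> \<gamma>) \<circ> (\<lambda>r. r - len)) has_vector_derivative 1 *\<^sub>R V c s) (at (s + len))"
    by (rule vector_diff_chain_at)
  moreover have "(snd c \<circ> \<gamma>) \<circ> (\<lambda>r. r - len) = snd c \<circ> \<gamma>"
    using periodic[of "r - len" for r] by (auto simp: fun_eq_iff)
  ultimately show ?thesis
    unfolding velocity_def by (simp add: vector_derivative_at)
qed

lemma velocity_chart_change: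
  assumes d: "d \<in> \<A>" "\<gamma> s \<in> fst d"
  shows "V d s = deriv (coord_change c d) (snd c (\<gamma> s)) * V c s"
proof -
  have "((coord_change c d \<circ> (snd c \<circ> \<gamma>)) has_vector_derivative
      V c s * deriv (coord_change c d) (snd c (\<gamma> s))) (at s)"
    using has_velocity coord_change_has_derivative[OF atlas c(1) d(1) c(2) d(2)]
    by (intro field_vector_diff_chain_at) simp_all
  moreover have "eventually (\<lambda>r. (coord_change c d \<circ> (snd c \<circ> \<gamma>)) r = (snd d \<circ> \<gamma>) r) (nhds s)"
    using eventually_in_chart[OF c]
    by eventually_elim (simp add: coord_change_def inv_into_f_f[OF chart_inj[OF chart[OF c(1)]]])
  ultimately have "((snd d \<circ> \<gamma>) has_vector_derivative
      V c s * deriv (coord_change c d) (snd c (\<gamma> s))) (at s)"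
    by (rule has_vector_derivative_eventually_eq)
  then show ?thesis unfolding velocity_def by (simp add: vector_derivative_at mult.commute)
qed

end

abbreviation "loop \<equiv> geodesic_loop \<gamma> len"

lemma loop_has_velocity:
  assumes "c \<in> \<A>" "loop s \<in> fst c"
  shows "((snd c \<circ> loop) has_vector_derivative complex_of_real len * V c (len * s)) (at s)"
proof -
  have "((\<lambda>s. len * s) has_vector_derivative len) (at s)"
    by (auto intro!: derivative_eq_intros)
  moreover have "((snd c \<circ> \<gamma>) has_vector_derivative V c (len * s)) (at (len * s))"
    using assms by (intro has_velocity) (simp_all add: geodesic_loop_def)
  ultimately have "(((snd c \<circ> \<gamma>) \<circ> (\<lambda>s. len * s)) has_vector_derivative len *\<^sub>R V c (len * s)) (at s)"
    by (rule vector_diff_chain_at)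
  moreover have "(snd c \<circ> \<gamma>) \<circ> (\<lambda>s. len * s) = snd c \<circ> loop"
    by (auto simp: geodesic_loop_def)
  ultimately show ?thesis by (simp add: scaleR_conv_of_real)
qed

lemma loop_velocity:
  assumes "c \<in> \<A>" "loop s \<in> fst c"
  shows "velocity c loop s = complex_of_real len * V c (len * s)"
  using loop_has_velocity[OF assms] unfolding velocity_def by (simp add: vector_derivative_at)

lemma loop_velocity_has_derivative:
  assumes "c \<in> \<A>" "loop s \<in> fst c"
  shows "((\<lambda>s. V c (len * s)) has_vector_derivative
    complex_of_real len * (- del_z (\<lambda>w. ln (h c w)) (snd c (loop s)) * (V c (len * s))\<^sup>2)) (at s)"
proof -
  have "((\<lambda>s. len * s) has_vector_derivative len) (at s)"
    by (auto intro!: derivative_eq_intros)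
  from vector_diff_chain_at[OF this geodesic_equation[of c "len * s"]] assms
  show ?thesis by (simp add: geodesic_loop_def o_def scaleR_conv_of_real)
qed

text \<open>The geodesic equation makes the velocity differentiable, hence continuous. This admits
  the geodesic as a test loop for monodromy and tangent class.\<close>

lemma loop_in_pw_C1_loops: "loop \<in> pw_C1_loops_at \<A> (\<gamma> 0)"
proof -
  have "continuous_on {0..1} loop"
    unfolding geodesic_loop_def
    by (intro continuous_on_compose2[OF continuous_\<gamma>] continuous_intros) auto
  moreover have "\<gamma> len = \<gamma> 0" using periodic[of 0] by simp
  ultimately have "loop \<in> loops_at (\<gamma> 0)"
    by (simp add: loops_at_def path_def pathstart_def pathfinish_def geodesic_loop_def)
  moreover have "(snd c \<circ> loop) piecewise_C1_differentiable_on {a..b}"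
    if "c \<in> \<A>" "loop ` {a..b} \<subseteq> fst c" for c a b
  proof (rule C1_differentiable_imp_piecewise)
    have "continuous_on {a..b} (\<lambda>s. complex_of_real len * V c (len * s))"
      using that
      by (intro continuous_intros continuous_at_imp_continuous_on ballI
          has_vector_derivative_continuous[OF loop_velocity_has_derivative]) auto
    moreover have "\<forall>s\<in>{a..b}. ((snd c \<circ> loop) has_vector_derivative complex_of_real len * V c (len * s)) (at s)"
      using that by (intro ballI loop_has_velocity) auto
    ultimately show "(snd c \<circ> loop) C1_differentiable_on {a..b}"
      unfolding C1_differentiable_on_def by (intro exI conjI)
  qed
  ultimately show ?thesis by (auto simp: pw_C1_loops_at_def)
qed

end

section \<open>Sections along a closed geodesic\<close>

text \<open>Written through the logarithmic derivative w'/w, into which the geodesic equation can be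
  substituted directly.\<close>

lemma has_vector_derivative_inverse_power_int:
  fixes w :: "real \<Rightarrow> complex"
  assumes w: "(w has_vector_derivative w') (at s)" and nz: "w s \<noteq> 0" "r \<noteq> 0"
  shows "((\<lambda>s. inverse (r * w s) powi m) has_vector_derivative
    - of_int m * (w' / w s) * inverse (r * w s) powi m) (at s)"
proof -
  have "((\<lambda>z. inverse (r * z)) has_field_derivative - (inverse (r * w s) * r * inverse (r * w s))) (at (w s))"
    using nz by (auto intro!: derivative_eq_intros)
  then have "((\<lambda>z. inverse (r * z) powi m) has_field_derivative
      of_int m * inverse (r * w s) powi (m - 1) * - (inverse (r * w s) * r * inverse (r * w s))) (at (w s))"
    by (rule DERIV_power_int) (use nz in simp)
  from field_vector_diff_chain_at[OF w this]
  have "((\<lambda>s. inverse (r * w s) powi m) has_vector_derivative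
      w' * (of_int m * inverse (r * w s) powi (m - 1) * - (inverse (r * w s) * r * inverse (r * w s)))) (at s)"
    by (simp only: o_def)
  moreover have "inverse (r * w s) powi m = inverse (r * w s) powi (m - 1) * inverse (r * w s)"
    using nz power_int_add_1[of "inverse (r * w s)" "m - 1"] by simp
  then have "- of_int m * (w' / w s) * inverse (r * w s) powi m
      = - of_int m * (w' / w s) * (inverse (r * w s) powi (m - 1) * inverse (r * w s))"
    by (simp only:)
  moreover have "1 / w s = r * inverse (r * w s)" using nz by (simp add: field_simps)
  then have "w' / w s = w' * (r * inverse (r * w s))" by (metis times_divide_eq_right mult_1_right)
  ultimately show ?thesis by (simp only: mult_minus_left mult_minus_right mult_ac)
qed

lemma lie_bracket_carrier [simp]:
  "A \<in> carrier_mat n n \<Longrightarrow> B \<in> carrier_mat n n \<Longrightarrow> lie_bracket A B \<in> carrier_mat n n"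
  by (auto simp: lie_bracket_def intro!: carrier_matI)

lemma lie_bracket_index:
  assumes "A \<in> carrier_mat n n" "B \<in> carrier_mat n n" "i < n" "j < n"
  shows "lie_bracket A B $$ (i, j) = (A * B) $$ (i, j) - (B * A) $$ (i, j)"
  using assms by (simp add: lie_bracket_def)

lemma lie_bracket_G_transition:
  assumes "t \<noteq> 0" "A \<in> carrier_mat n n" "B \<in> carrier_mat n n"
  shows "lie_bracket (L \<cdot>\<^sub>m G_transition n t A) (G_transition n t B)
    = L \<cdot>\<^sub>m G_transition n t (lie_bracket A B)" (is "?l = ?r")
proof (rule eq_matI)
  fix i j assume "i < dim_row ?r" "j < dim_col ?r"
  then have ij: "i < n" "j < n" by (simp_all add: G_transition_def)
  have AB: "A * B \<in> carrier_mat n n" "B * A \<in> carrier_mat n n" using assms by auto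
  have "?l $$ (i, j) = L * G_transition n t (A * B) $$ (i, j) - L * G_transition n t (B * A) $$ (i, j)"
    using ij assms carrier_matD[OF G_transition_carrier[of n t]]
    by (subst lie_bracket_index[of _ n])
      (simp_all add: mult_smult_assoc_mat[of _ n n _ n] mult_smult_distrib[of _ n n _ n] G_transition_mult)
  also have "\<dots> = ?r $$ (i, j)"
    using ij assms AB carrier_matD[OF G_transition_carrier[of n t]]
    by (simp add: G_transition_index lie_bracket_index[of _ n] right_diff_distrib)
  finally show "?l $$ (i, j) = ?r $$ (i, j)" .
qed (use carrier_matD[OF G_transition_carrier[of n t]] in \<open>simp_all add: lie_bracket_def\<close>)

context unit_speed_geodesic
begin

text \<open>The factor that turns the coefficient of $dz$ into the value on $\sqrt2\,\dot\gamma$,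
  which has norm 1 in the hermitian metric, is the inverse of \<open>frame\<close>.\<close>

definition frame :: "'a chart \<Rightarrow> real \<Rightarrow> complex" where
  "frame c s = inverse (complex_of_real (sqrt 2) * V c (len * s))"

definition framed :: "nat \<Rightarrow> (real \<Rightarrow> complex mat) \<Rightarrow> 'a chart \<Rightarrow> real \<Rightarrow> complex mat" where
  "framed n U c s = G_transition n (frame c s) (U s)"

lemma loop_in_chart: "loop s \<in> fst c \<longleftrightarrow> \<gamma> (len * s) \<in> fst c"
  by (simp add: geodesic_loop_def)

lemma frame_nonzero: "c \<in> \<A> \<Longrightarrow> loop s \<in> fst c \<Longrightarrow> frame c s \<noteq> 0"
  using velocity_nonzero by (simp add: frame_def loop_in_chart)

text \<open>U does not depend on a chart. The velocity is multiplied by the derivative of a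
  coordinate change, so its inverse transforms the opposite way, which is the transition rule that
  sections require.\<close>

lemma framed_G_section:
  assumes U: "\<And>s. s \<in> {0..1} \<Longrightarrow> U s \<in> carrier_mat n n" "\<And>s. s \<in> {0..1} \<Longrightarrow> mat_trace (U s) = 0"
  shows "G_section_along \<A> n loop (framed n U)"
proof -
  have step: "frame c s = deriv (coord_change c d) (snd c (loop s)) * frame d s"
    if "c \<in> \<A>" "d \<in> \<A>" "loop s \<in> fst c" "loop s \<in> fst d" for c d s
  proof -
    let ?D = "deriv (coord_change c d) (snd c (\<gamma> (len * s)))"
    have "V d (len * s) = ?D * V c (len * s)"
      using that by (intro velocity_chart_change) (simp_all add: loop_in_chart)
    moreover have "V d (len * s) \<noteq> 0"
      using that by (intro velocity_nonzero) (simp_all add: loop_in_chart)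
    ultimately show ?thesis by (simp add: frame_def geodesic_loop_def)
  qed
  show ?thesis
    unfolding G_section_along_def
  proof (intro conjI ballI impI)
    fix c d s assume "c \<in> \<A>" "d \<in> \<A>" "loop s \<in> fst c \<inter> fst d"
    then show "framed n U c s = G_transition n (deriv (coord_change c d) (snd c (loop s))) (framed n U d s)"
      unfolding framed_def G_transition_comp by (subst step[of c d s]) simp_all
  qed (simp_all add: framed_def U)
qed

text \<open>Differentiating the frame factor of weight m yields m times the logarithmic derivative
  of h along the curve, exactly the negative of the Chern term. What survives is the equation U' =
  len (\<beta> - [S, U]) with constant S.\<close>

lemma framed_D_along_eq:
  assumes U: "\<And>s. U s \<in> carrier_mat n n" and \<beta>: "\<And>s. \<beta> s \<in> carrier_mat n n"
    and cont: "\<And>i j. i < n \<Longrightarrow> j < n \<Longrightarrow> continuous_on {0..1} (\<lambda>s. U s $$ (i, j))"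
    and ode: "\<And>s i j. 0 < s \<Longrightarrow> s < 1 \<Longrightarrow> i < n \<Longrightarrow> j < n \<Longrightarrow>
      ((\<lambda>s. U s $$ (i, j)) has_vector_derivative
        complex_of_real len * (\<beta> s - lie_bracket (spin_mat n) (U s)) $$ (i, j)) (at s)"
    and \<alpha>: "\<And>c s. c \<in> \<A> \<Longrightarrow> loop s \<in> fst c \<Longrightarrow>
      \<alpha> c (snd c (loop s)) (velocity c loop s) = complex_of_real len \<cdot>\<^sub>m G_transition n (frame c s) (\<beta> s)"
  shows "D_along_eq \<A> n h loop (framed n U) \<alpha>"
  unfolding D_along_eq_def
\<comment> \<open>The endpoints are exceptional because U is assumed to have a two-sided derivative
  only inside the interval.\<close>
proof (intro ballI allI impI conjI exI[of _ "{0, 1}"])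
  fix c a b i j assume c: "c \<in> \<A>" and ab: "0 \<le> a \<and> a < b \<and> b \<le> 1 \<and> loop ` {a..b} \<subseteq> fst c"
    and ij: "i < n" "j < n"
  let ?m = "int i - int j" and ?r = "complex_of_real (sqrt 2)"
  have entry: "framed n U c s $$ (i, j) = frame c s powi ?m * U s $$ (i, j)" for s
    using ij by (simp add: framed_def G_transition_index)
  \<comment> \<open>The geodesic equation gives w'/w = - len times the z-derivative of log h times
    the velocity; the inverse in the frame turns the sign round.\<close>
  have frame_deriv: "((\<lambda>s. frame c s powi ?m) has_vector_derivative
      complex_of_real len * (of_int ?m * del_z (\<lambda>w. ln (h c w)) (snd c (loop s)) * V c (len * s))
        * frame c s powi ?m) (at s)" if s: "loop s \<in> fst c" for s
  proof -
    let ?v = "V c (len * s)" and ?d = "del_z (\<lambda>w. ln (h c w)) (snd c (loop s))"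
    have nz: "?v \<noteq> 0" using velocity_nonzero[of c "len * s"] c s by (simp add: loop_in_chart)
    then have div: "- of_int k * (complex_of_real len * (- ?d * ?v\<^sup>2) / ?v)
        = complex_of_real len * (of_int k * ?d * ?v)" for k
      by (simp add: power2_eq_square)
    have "?r \<noteq> 0" by simp
    from has_vector_derivative_inverse_power_int[OF loop_velocity_has_derivative[OF c s] nz this, of ?m]
    show ?thesis unfolding frame_def div .
  qed
  {
    show "continuous_on {a..b} (\<lambda>s. framed n U c s $$ (i, j))"
      unfolding entry
    proof (intro continuous_on_mult)
      show "continuous_on {a..b} (\<lambda>s. frame c s powi ?m)"
        using ab by (intro continuous_at_imp_continuous_on ballI has_vector_derivative_continuous[OF frame_deriv]) auto
      show "continuous_on {a..b} (\<lambda>s. U s $$ (i, j))"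
        using ab by (intro continuous_on_subset[OF cont[OF ij]]) auto
    qed
  next
    fix s assume "s \<in> {a..b} - {0, 1}"
    then have s: "0 < s" "s < 1" "loop s \<in> fst c" using ab by auto
    let ?v = "V c (len * s)" and ?d = "del_z (\<lambda>w. ln (h c w)) (snd c (loop s))" and ?L = "complex_of_real len"
    let ?t = "frame c s" and ?B = "lie_bracket (spin_mat n) (U s)"
    have unit: "2 * h c (snd c (loop s)) * (cmod ?v)\<^sup>2 = 1"
      using unit_velocity[of c "len * s"] c s by (simp add: geodesic_loop_def)
    have "D_form n h c (snd c (loop s)) (velocity c loop s) (framed n U c s)
        = chern_form n h c (snd c (loop s)) (?L * ?v) (framed n U c s)
          + ?L \<cdot>\<^sub>m G_transition n ?t ?B"
      unfolding D_form_def loop_velocity[OF c s(3)] Higgs_form_frame[OF unit] framed_def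
        frame_def[symmetric]
      by (subst lie_bracket_G_transition[OF frame_nonzero[OF c s(3)] spin_carrier(1) U]) (rule refl)
    then have D: "D_form n h c (snd c (loop s)) (velocity c loop s) (framed n U c s) $$ (i, j)
        = - of_int ?m * ?d * (?L * ?v) * (?t powi ?m * U s $$ (i, j)) + ?L * (?t powi ?m * ?B $$ (i, j))"
      using ij carrier_matD[OF G_transition_carrier[of n ?t]]
      by (simp add: chern_form_def entry G_transition_index)
    have dims: "dim_row (D_form n h c (snd c (loop s)) (velocity c loop s) (framed n U c s)) = n"
      "dim_col (D_form n h c (snd c (loop s)) (velocity c loop s) (framed n U c s)) = n"
      by (simp_all add: D_form_def lie_bracket_def framed_def G_transition_def cartan_inv_def Phi0_def Y_mat_def)
    have "(\<alpha> c (snd c (loop s)) (velocity c loop s)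
        - D_form n h c (snd c (loop s)) (velocity c loop s) (framed n U c s)) $$ (i, j)
        = ?L * (?t powi ?m * \<beta> s $$ (i, j))
          - (- of_int ?m * ?d * (?L * ?v) * (?t powi ?m * U s $$ (i, j)) + ?L * (?t powi ?m * ?B $$ (i, j)))"
      using ij dims D carrier_matD[OF G_transition_carrier[of n ?t]]
      by (simp add: \<alpha>[OF c s(3)] G_transition_index)
    also have "\<dots> = ?t powi ?m * (?L * (\<beta> s - ?B) $$ (i, j))
        + ?L * (of_int ?m * ?d * ?v) * ?t powi ?m * U s $$ (i, j)"
      using ij carrier_matD[OF lie_bracket_carrier[OF spin_carrier(1) U, of s]] carrier_matD[OF \<beta>[of s]]
      by (simp add: algebra_simps)
    finally have eq: "(\<alpha> c (snd c (loop s)) (velocity c loop s)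
        - D_form n h c (snd c (loop s)) (velocity c loop s) (framed n U c s)) $$ (i, j)
      = ?t powi ?m * (?L * (\<beta> s - ?B) $$ (i, j)) + ?L * (of_int ?m * ?d * ?v) * ?t powi ?m * U s $$ (i, j)" .
    show "((\<lambda>s. framed n U c s $$ (i, j)) has_vector_derivative
        (\<alpha> c (snd c (loop s)) (velocity c loop s)
          - D_form n h c (snd c (loop s)) (velocity c loop s) (framed n U c s)) $$ (i, j)) (at s)"
      unfolding eq entry
      by (rule has_vector_derivative_mult[OF frame_deriv[OF s(3)] ode[OF s(1,2) ij]])
  }
qed simp

end

section \<open>Solving the transport equation\<close>

text \<open>Variation of constants. Since b is controlled only on the closed interval, the integral
  has one-sided derivatives at 0 and 1, and the two-sided derivative is claimed inside.\<close>

lemma linear_ode_solution: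
  fixes b :: "real \<Rightarrow> complex" and a :: real and y0 :: complex
  assumes b: "continuous_on {0..1} b"
  defines "y \<equiv> \<lambda>s. complex_of_real (exp (- a * s)) * (y0 + integral {0..s} (\<lambda>r. complex_of_real (exp (a * r)) * b r))"
  shows "continuous_on {0..1} y"
    and "0 < s \<Longrightarrow> s < 1 \<Longrightarrow> (y has_vector_derivative b s - complex_of_real a * y s) (at s)"
proof -
  let ?g = "\<lambda>r. complex_of_real (exp (a * r)) * b r"
  have g: "continuous_on {0..1} ?g" by (intro continuous_intros b)
  have "((\<lambda>x. complex_of_real (exp (- a * x))) has_vector_derivative
      complex_of_real (- a * exp (- a * s))) (at s within S)" for s S
    by (rule has_vector_derivative_of_real) (auto intro!: derivative_eq_intros)
  then have deriv: "(y has_vector_derivative complex_of_real (exp (- a * s)) * ?g s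
      + complex_of_real (- a * exp (- a * s)) * (y0 + integral {0..s} ?g)) (at s within {0..1})"
    if "s \<in> {0..1}" for s
    unfolding y_def
    by (intro has_vector_derivative_mult)
      (auto intro!: derivative_eq_intros integral_has_vector_derivative[OF g that])
  have rhs: "complex_of_real (exp (- a * s)) * ?g s + complex_of_real (- a * exp (- a * s)) * (y0 + integral {0..s} ?g)
    = b s - complex_of_real a * y s" for s
  proof -
    have "complex_of_real (exp (- a * s)) * ?g s = complex_of_real (exp (- a * s) * exp (a * s)) * b s"
      by (simp only: of_real_mult mult.assoc)
    also have "exp (- a * s) * exp (a * s) = 1" by (simp flip: exp_add)
    finally show ?thesis by (simp add: y_def algebra_simps)
  qed
  show "continuous_on {0..1} y"
    unfolding continuous_on_eq_continuous_within
    using has_vector_derivative_continuous[OF deriv] by blast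
  show "(y has_vector_derivative b s - complex_of_real a * y s) (at s)" if "0 < s" "s < 1"
  proof -
    have "at s within {0..1} = at s" using that by (intro at_within_interior) simp
    then show ?thesis using deriv[of s] that unfolding rhs by simp
  qed
qed

text \<open>The solution of Y' = L (B - [D, Y]) with Y(0) = Y0 and D the diagonal matrix of weights:
  the bracket with D acts on the entry (i, j) as multiplication by a weight difference, so each
  entry obeys its own scalar equation.\<close>

definition diag_flow :: "nat \<Rightarrow> real \<Rightarrow> (real \<Rightarrow> complex mat) \<Rightarrow> complex mat \<Rightarrow> real \<Rightarrow> complex mat" where
  "diag_flow n L B Y0 s = mat n n (\<lambda>(i, j).
     complex_of_real (exp (- (L * (spin_weight n i - spin_weight n j)) * s)) *
     (Y0 $$ (i, j) + integral {0..s} (\<lambda>r. complex_of_real (exp (L * (spin_weight n i - spin_weight n j) * r))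
        * (complex_of_real L * B r $$ (i, j)))))"

lemma diag_flow_carrier [simp]: "diag_flow n L B Y0 s \<in> carrier_mat n n"
  by (simp add: diag_flow_def)

lemma diag_flow_0: "Y0 \<in> carrier_mat n n \<Longrightarrow> diag_flow n L B Y0 0 = Y0"
  by (rule eq_matI) (auto simp: diag_flow_def)

lemma weight_exp_conj_index:
  assumes "Y \<in> carrier_mat n n" "i < n" "j < n"
  shows "(weight_exp n s * Y * weight_exp n t) $$ (i, j)
    = complex_of_real (exp (s * spin_weight n i + t * spin_weight n j)) * Y $$ (i, j)"
proof -
  have left: "(weight_exp n s * Y) $$ (i, k) = complex_of_real (exp (s * spin_weight n i)) * Y $$ (i, k)"
    if "k < n" for k
  proof -
    have "(weight_exp n s * Y) $$ (i, k)
        = (\<Sum>l<n. if l = i then complex_of_real (exp (s * spin_weight n i)) * Y $$ (i, k) else 0)"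
      unfolding mult_mat_entry[OF spin_carrier(5) assms(1,2) that]
      by (intro sum.cong refl) (use assms in \<open>auto simp: weight_exp_def\<close>)
    then show ?thesis using assms by simp
  qed
  have WY: "weight_exp n s * Y \<in> carrier_mat n n"
    using assms(1) by (rule mult_carrier_mat[OF spin_carrier(5)])
  have "(weight_exp n s * Y * weight_exp n t) $$ (i, j)
      = (\<Sum>k<n. if k = j then (weight_exp n s * Y) $$ (i, j) * complex_of_real (exp (t * spin_weight n j)) else 0)"
    unfolding mult_mat_entry[OF WY spin_carrier(5) assms(2,3)]
    by (intro sum.cong refl) (use assms in \<open>auto simp: weight_exp_def\<close>)
  then show ?thesis using assms by (simp add: left exp_add)
qed

lemma diag_flow_homogeneous:
  assumes "Y0 \<in> carrier_mat n n"
  shows "diag_flow n L (\<lambda>_. 0\<^sub>m n n) Y0 1 = weight_exp n (- L) * Y0 * weight_exp n L"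
proof (rule eq_matI)
  fix i j assume "i < dim_row (weight_exp n (- L) * Y0 * weight_exp n L)"
    "j < dim_col (weight_exp n (- L) * Y0 * weight_exp n L)"
  then have "i < n" "j < n" by (simp_all add: weight_exp_def)
  then show "diag_flow n L (\<lambda>_. 0\<^sub>m n n) Y0 1 $$ (i, j) = (weight_exp n (- L) * Y0 * weight_exp n L) $$ (i, j)"
    using assms by (simp add: weight_exp_conj_index diag_flow_def algebra_simps)
qed (simp_all add: diag_flow_def weight_exp_def)

lemma weight_bracket_index:
  assumes "Y \<in> carrier_mat n n" "i < n" "j < n"
  shows "lie_bracket (weight_mat n) Y $$ (i, j)
    = complex_of_real (spin_weight n i - spin_weight n j) * Y $$ (i, j)"
proof -
  have "(weight_mat n * Y) $$ (i, j) = (\<Sum>k<n. if k = i then complex_of_real (spin_weight n i) * Y $$ (i, j) else 0)"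
    unfolding mult_mat_entry[OF spin_carrier(4) assms]
    by (intro sum.cong refl) (use assms in \<open>auto simp: weight_mat_def\<close>)
  moreover have "(Y * weight_mat n) $$ (i, j) = (\<Sum>k<n. if k = j then complex_of_real (spin_weight n j) * Y $$ (i, j) else 0)"
    unfolding mult_mat_entry[OF assms(1) spin_carrier(4) assms(2,3)]
    by (intro sum.cong refl) (use assms in \<open>auto simp: weight_mat_def\<close>)
  ultimately show ?thesis
    using assms by (simp add: lie_bracket_index[of _ n] algebra_simps)
qed

lemma diag_flow_ode:
  assumes B: "\<And>s. B s \<in> carrier_mat n n" and ij: "i < n" "j < n"
    and cont: "continuous_on {0..1} (\<lambda>s. B s $$ (i, j))"
  shows "continuous_on {0..1} (\<lambda>s. diag_flow n L B Y0 s $$ (i, j))"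
    and "0 < s \<Longrightarrow> s < 1 \<Longrightarrow> ((\<lambda>s. diag_flow n L B Y0 s $$ (i, j)) has_vector_derivative
      complex_of_real L * (B s - lie_bracket (weight_mat n) (diag_flow n L B Y0 s)) $$ (i, j)) (at s)"
proof -
  define a where "a = L * (spin_weight n i - spin_weight n j)"
  have entry: "diag_flow n L B Y0 s $$ (i, j) = complex_of_real (exp (- a * s)) *
     (Y0 $$ (i, j) + integral {0..s} (\<lambda>r. complex_of_real (exp (a * r)) * (complex_of_real L * B r $$ (i, j))))" for s
    using ij by (simp add: diag_flow_def a_def)
  have b: "continuous_on {0..1} (\<lambda>s. complex_of_real L * B s $$ (i, j))"
    by (intro continuous_intros cont)
  show "continuous_on {0..1} (\<lambda>s. diag_flow n L B Y0 s $$ (i, j))"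
    unfolding entry by (rule linear_ode_solution(1)[OF b])
  assume s: "0 < s" "s < 1"
  have "complex_of_real L * (B s - lie_bracket (weight_mat n) (diag_flow n L B Y0 s)) $$ (i, j)
    = complex_of_real L * B s $$ (i, j) - complex_of_real a * diag_flow n L B Y0 s $$ (i, j)"
    using ij carrier_matD[OF lie_bracket_carrier[OF spin_carrier(4) diag_flow_carrier[of n L B Y0 s]]]
      carrier_matD[OF B[of s]]
    by (simp add: weight_bracket_index[of _ n] a_def algebra_simps)
  then show "((\<lambda>s. diag_flow n L B Y0 s $$ (i, j)) has_vector_derivative
      complex_of_real L * (B s - lie_bracket (weight_mat n) (diag_flow n L B Y0 s)) $$ (i, j)) (at s)"
    using linear_ode_solution(2)[OF b s, of a "Y0 $$ (i, j)"] unfolding entry by simp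
qed

text \<open>On the diagonal the weight difference is 0, so the trace of the flow is the initial
  trace plus an integral of the trace of the source. This keeps the constructed sections in sl(n),
  as \<open>G_section_along\<close> demands.\<close>

lemma mat_trace_diag_flow:
  assumes B: "\<And>s. B s \<in> carrier_mat n n" "\<And>s. mat_trace (B s) = 0"
    and Y0: "Y0 \<in> carrier_mat n n" "mat_trace Y0 = 0"
    and cont: "\<And>i. i < n \<Longrightarrow> continuous_on {0..1} (\<lambda>s. B s $$ (i, i))" and s: "s \<in> {0..1}"
  shows "mat_trace (diag_flow n L B Y0 s) = 0"
proof -
  have int: "(\<lambda>r. complex_of_real L * B r $$ (i, i)) integrable_on {0..s}" if "i < n" for i
    using s by (intro integrable_continuous_real continuous_intros continuous_on_subset[OF cont[OF that]]) auto
  have "mat_trace (diag_flow n L B Y0 s)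
      = (\<Sum>i<n. Y0 $$ (i, i) + integral {0..s} (\<lambda>r. complex_of_real L * B r $$ (i, i)))"
    by (simp add: mat_trace_carrier[of _ n]) (simp add: diag_flow_def)
  also have "\<dots> = (\<Sum>i<n. Y0 $$ (i, i)) + integral {0..s} (\<lambda>r. \<Sum>i<n. complex_of_real L * B r $$ (i, i))"
    unfolding sum.distrib using int by (subst integral_sum) auto
  also have "\<dots> = mat_trace Y0 + integral {0..s} (\<lambda>r. complex_of_real L * mat_trace (B r))"
    by (simp only: mat_trace_carrier[OF Y0(1)] mat_trace_carrier[OF B(1)] sum_distrib_left)
  finally show ?thesis using Y0 B by simp
qed

lemma triple_product_index:
  assumes "A \<in> carrier_mat n n" "Y \<in> carrier_mat n n" "C \<in> carrier_mat n n" "i < n" "j < n"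
  shows "(A * Y * C) $$ (i, j) = (\<Sum>l<n. \<Sum>k<n. A $$ (i, k) * Y $$ (k, l) * C $$ (l, j))"
proof -
  have "(A * Y * C) $$ (i, j) = (\<Sum>l<n. (A * Y) $$ (i, l) * C $$ (l, j))"
    using assms by (intro mult_mat_entry) auto
  also have "\<dots> = (\<Sum>l<n. \<Sum>k<n. A $$ (i, k) * Y $$ (k, l) * C $$ (l, j))"
    by (intro sum.cong refl) (simp only: lessThan_iff mult_mat_entry[OF assms(1,2,4)] sum_distrib_right)
  finally show ?thesis .
qed

text \<open>Source and initial value are given in the eigenbasis of S; only the resulting flow is
  carried back to the unit frame, where the source appears as
  \<open>kraw_inv n * B s * kraw_mat n\<close>.\<close>

definition spin_flow :: "nat \<Rightarrow> real \<Rightarrow> (real \<Rightarrow> complex mat) \<Rightarrow> complex mat \<Rightarrow> real \<Rightarrow> complex mat" where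
  "spin_flow n L B Y0 s = kraw_inv n * diag_flow n L B Y0 s * kraw_mat n"

lemma spin_flow_carrier [simp]: "spin_flow n L B Y0 s \<in> carrier_mat n n"
  by (simp add: spin_flow_def mult_carrier_mat[of _ n n _ n])

lemma mat_trace_spin_flow:
  assumes "0 < n"
  shows "mat_trace (spin_flow n L B Y0 s) = mat_trace (diag_flow n L B Y0 s)"
proof -
  have "spin_flow n L B Y0 s = kraw_inv n * (diag_flow n L B Y0 s * kraw_mat n)"
    unfolding spin_flow_def by (rule assoc_mult_mat) (rule spin_carrier diag_flow_carrier)+
  then have "mat_trace (spin_flow n L B Y0 s) = mat_trace ((diag_flow n L B Y0 s * kraw_mat n) * kraw_inv n)"
    by (simp add: mat_trace_mult_commute[of _ n] mult_carrier_mat[of _ n n _ n])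
  also have "(diag_flow n L B Y0 s * kraw_mat n) * kraw_inv n = diag_flow n L B Y0 s * (kraw_mat n * kraw_inv n)"
    by (rule assoc_mult_mat) (rule spin_carrier diag_flow_carrier)+
  also have "\<dots> = diag_flow n L B Y0 s"
    unfolding kraw_mat_inv(1)[OF assms] by (rule right_mult_one_mat) (rule diag_flow_carrier)
  finally show ?thesis .
qed

text \<open>The change of basis intertwines the brackets with D and with S. Besides W S = D W this
  uses V D = S V for the inverse V of W, obtained by inserting W V = 1.\<close>

lemma spin_bracket_conj:
  assumes n: "0 < n" and Y: "Y \<in> carrier_mat n n" and B: "B \<in> carrier_mat n n"
  shows "kraw_inv n * (B - lie_bracket (weight_mat n) Y) * kraw_mat n
    = kraw_inv n * B * kraw_mat n - lie_bracket (spin_mat n) (kraw_inv n * Y * kraw_mat n)"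
proof -
  let ?W = "kraw_mat n" and ?V = "kraw_inv n" and ?D = "weight_mat n" and ?S = "spin_mat n"
  note assoc = assoc_mult_mat[of _ n n _ n _ n] and c [simp] = mult_carrier_mat[of _ n n _ n]
  note [simp] = Y B
  have VW: "?V * (?W * X) = X" "?W * (?V * X) = X" if "X \<in> carrier_mat n n" for X
    using that kraw_mat_inv[OF n] by (metis assoc left_mult_one_mat spin_carrier(2,3))+
  have DS: "?V * (?D * X) = ?S * (?V * X)" if X: "X \<in> carrier_mat n n" for X
  proof -
    have "?V * (?D * X) = ?V * ((?D * ?W) * (?V * X))" using X by (simp add: assoc VW)
    also have "\<dots> = ?V * ((?W * ?S) * (?V * X))" by (simp only: kraw_diagonalises_spin[OF n])
    also have "\<dots> = ?S * (?V * X)" using X by (simp add: assoc VW)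
    finally show ?thesis .
  qed
  have WS: "?W * ?S = ?D * ?W" by (rule kraw_diagonalises_spin[OF n])
  have sandwich_minus: "?V * (F - G) * ?W = ?V * F * ?W - ?V * G * ?W"
    if "F \<in> carrier_mat n n" "G \<in> carrier_mat n n" for F G
  proof -
    have "?V * (F - G) = ?V * F - ?V * G"
      using that by (intro mult_minus_distrib_mat[of _ n n _ n]) simp_all
    moreover have "(?V * F - ?V * G) * ?W = ?V * F * ?W - ?V * G * ?W"
      using that by (intro minus_mult_distrib_mat[of _ n n _ _ n]) simp_all
    ultimately show ?thesis by (simp only:)
  qed
  have "?V * (B - lie_bracket ?D Y) * ?W = ?V * B * ?W - (?V * (?D * Y) * ?W - ?V * (Y * ?D) * ?W)"
  proof -
    have "?D * Y - Y * ?D \<in> carrier_mat n n" by (intro minus_carrier_mat) simp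
    then show ?thesis by (simp only: lie_bracket_def sandwich_minus B c Y spin_carrier)
  qed
  also have "?V * (?D * Y) * ?W = ?S * (?V * Y * ?W)" by (simp add: assoc DS)
  also have "?V * (Y * ?D) * ?W = (?V * Y * ?W) * ?S" by (simp add: assoc WS)
  finally show ?thesis by (simp only: lie_bracket_def)
qed

lemma spin_flow_ode:
  assumes n: "0 < n" and B: "\<And>s. B s \<in> carrier_mat n n" and ij: "i < n" "j < n"
    and cont: "\<And>i j. i < n \<Longrightarrow> j < n \<Longrightarrow> continuous_on {0..1} (\<lambda>s. B s $$ (i, j))"
  shows "continuous_on {0..1} (\<lambda>s. spin_flow n L B Y0 s $$ (i, j))"
    and "0 < s \<Longrightarrow> s < 1 \<Longrightarrow> ((\<lambda>s. spin_flow n L B Y0 s $$ (i, j)) has_vector_derivative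
      complex_of_real L * (kraw_inv n * B s * kraw_mat n
        - lie_bracket (spin_mat n) (spin_flow n L B Y0 s)) $$ (i, j)) (at s)"
proof -
  have entry: "spin_flow n L B Y0 s $$ (i, j)
    = (\<Sum>l<n. \<Sum>k<n. kraw_inv n $$ (i, k) * diag_flow n L B Y0 s $$ (k, l) * kraw_mat n $$ (l, j))" for s
    unfolding spin_flow_def by (rule triple_product_index[OF _ _ _ ij]) simp_all
  show "continuous_on {0..1} (\<lambda>s. spin_flow n L B Y0 s $$ (i, j))"
    unfolding entry by (intro continuous_intros diag_flow_ode(1) B cont) auto
  assume s: "0 < s" "s < 1"
  let ?E = "\<lambda>k l. (B s - lie_bracket (weight_mat n) (diag_flow n L B Y0 s)) $$ (k, l)"
  have "((\<lambda>s. spin_flow n L B Y0 s $$ (i, j)) has_vector_derivative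
      (\<Sum>l<n. \<Sum>k<n. kraw_inv n $$ (i, k) * (complex_of_real L * ?E k l) * kraw_mat n $$ (l, j))) (at s)"
    unfolding entry
    by (intro has_vector_derivative_sum has_vector_derivative_mult_left has_vector_derivative_mult_right
        diag_flow_ode(2) B cont s) auto
  also have "(\<Sum>l<n. \<Sum>k<n. kraw_inv n $$ (i, k) * (complex_of_real L * ?E k l) * kraw_mat n $$ (l, j))
      = complex_of_real L * (\<Sum>l<n. \<Sum>k<n. kraw_inv n $$ (i, k) * ?E k l * kraw_mat n $$ (l, j))"
    by (simp only: sum_distrib_left mult_ac)
  also have "\<dots> = complex_of_real L *
      (kraw_inv n * (B s - lie_bracket (weight_mat n) (diag_flow n L B Y0 s)) * kraw_mat n) $$ (i, j)"
    by (subst triple_product_index[OF _ _ _ ij])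
      (auto intro!: minus_carrier_mat lie_bracket_carrier)
  also have "\<dots> = complex_of_real L * (kraw_inv n * B s * kraw_mat n
        - lie_bracket (spin_mat n) (spin_flow n L B Y0 s)) $$ (i, j)"
    by (simp only: spin_bracket_conj[OF n diag_flow_carrier B] spin_flow_def)
  finally show "((\<lambda>s. spin_flow n L B Y0 s $$ (i, j)) has_vector_derivative
      complex_of_real L * (kraw_inv n * B s * kraw_mat n
        - lie_bracket (spin_mat n) (spin_flow n L B Y0 s)) $$ (i, j)) (at s)" .
qed

section \<open>The variation of the trace\<close>

text \<open>One term takes (-1)^i from the last Krawtchouk column, the other takes it from the last
  row. The signs agree, so f and its conjugate add up to 2 Re f. Diagonal entries suffice because
  the matrix will be paired with a diagonal exponential.\<close>

lemma kraw_conj_corner_diag: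
  assumes n: "2 \<le> n" and i: "i < n"
  shows "(kraw_mat n * corner_mat n f * kraw_inv n) $$ (i, i)
    = complex_of_real (2 * Re f * ((-1) ^ i * real ((n - 1) choose i) / 2 ^ (n - 1)))"
proof -
  define N where "N = n - 1"
  have N: "N < n" "0 < n" "N \<noteq> 0" using n by (auto simp: N_def)
  have nN: "n - Suc 0 = N" by (simp add: N_def)
  have iN: "i \<le> N" using i by (simp add: N_def)
  have corner: "corner_mat n f $$ (k, l) = (if k = N \<and> l = 0 then f else 0) + (if k = 0 \<and> l = N then cnj f else 0)"
    if "k < n" "l < n" for k l
    using that N by (auto simp: corner_mat_def N_def)
  have "(kraw_mat n * corner_mat n f * kraw_inv n) $$ (i, i)
      = (\<Sum>l<n. \<Sum>k<n. kraw_mat n $$ (i, k) * corner_mat n f $$ (k, l) * kraw_inv n $$ (l, i))"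
    by (rule triple_product_index) (simp_all add: i)
  also have "\<dots> = (\<Sum>l<n. \<Sum>k<n. (if k = N then if l = 0 then kraw_mat n $$ (i, N) * f * kraw_inv n $$ (0, i) else 0 else 0)
      + (if k = 0 then if l = N then kraw_mat n $$ (i, 0) * cnj f * kraw_inv n $$ (N, i) else 0 else 0))"
    by (intro sum.cong refl) (auto simp: corner ring_distribs)
  also have "\<dots> = kraw_mat n $$ (i, N) * f * kraw_inv n $$ (0, i) + kraw_mat n $$ (i, 0) * cnj f * kraw_inv n $$ (N, i)"
    using N by (simp add: sum.distrib)
  also have "kraw_mat n $$ (i, N) = (-1) ^ i"
    using i N kraw_last_column[OF iN] by (simp add: kraw_mat_def nN)
  also have "kraw_mat n $$ (i, 0) = 1"
    using i N by (simp add: kraw_mat_def kraw_first_column nN)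
  also have "kraw_inv n $$ (0, i) = complex_of_real (real (N choose i) / 2 ^ N)"
    using i N by (simp add: kraw_inv_def kraw_first_row nN)
  also have "kraw_inv n $$ (N, i) = complex_of_real ((-1) ^ i * real (N choose i) / 2 ^ N)"
    using i N by (simp add: kraw_inv_def kraw_last_row nN)
  also have "(-1) ^ i * f * complex_of_real (real (N choose i) / 2 ^ N)
      + 1 * cnj f * complex_of_real ((-1) ^ i * real (N choose i) / 2 ^ N)
    = (f + cnj f) * complex_of_real ((-1) ^ i * real (N choose i) / 2 ^ N)"
    by (simp add: algebra_simps add_divide_distrib)
  also have "f + cnj f = complex_of_real (2 * Re f)" by (rule complex_add_cnj)
  finally show ?thesis by (simp only: N_def of_real_mult)
qed

lemma mat_trace_corner: "2 \<le> n \<Longrightarrow> mat_trace (corner_mat n f) = 0"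
  by (simp add: mat_trace_carrier[of _ n]) (auto simp: corner_mat_def intro!: sum.neutral)

text \<open>The binomial expansion of ((e^(-L/2) - e^(L/2))/2)^(n-1): choosing the second
  exponential i times gives the total exponent L (i - (n-1)/2), which is -L times the i-th
  weight.\<close>

lemma sinh_power_weight_sum:
  assumes "0 < n"
  shows "(\<Sum>i<n. (-1) ^ i * real ((n - 1) choose i) / 2 ^ (n - 1) * exp (- L * spin_weight n i))
    = (- sinh (L / 2)) ^ (n - 1)"
proof -
  define N where "N = n - 1"
  have le: "{..<n} = {..N}" using assms by (auto simp: N_def)
  have weight: "spin_weight n i = real N / 2 - real i" for i
    using assms by (simp add: spin_weight_def N_def of_nat_diff)
  have "(- sinh (L / 2)) ^ N = ((- exp (L / 2) + exp (- (L / 2))) / 2) ^ N"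
    by (rule arg_cong[where f = "\<lambda>x. x ^ N"]) (simp add: sinh_def field_simps)
  also have "\<dots> = (\<Sum>i\<le>N. real (N choose i) * (- exp (L / 2)) ^ i * exp (- (L / 2)) ^ (N - i)) / 2 ^ N"
    by (simp only: power_divide binomial_ring)
  also have "\<dots> = (\<Sum>i\<le>N. (-1) ^ i * real (N choose i) / 2 ^ N * exp (- L * spin_weight n i))"
    unfolding sum_divide_distrib
  proof (intro sum.cong refl)
    fix i assume "i \<in> {..N}"
    then have "exp (L / 2) ^ i * exp (- (L / 2)) ^ (N - i) = exp (- L * spin_weight n i)"
      by (simp add: weight algebra_simps of_nat_diff diff_divide_distrib
          flip: exp_of_nat_mult exp_add)
    then show "real (N choose i) * (- exp (L / 2)) ^ i * exp (- (L / 2)) ^ (N - i) / 2 ^ N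
      = (-1) ^ i * real (N choose i) / 2 ^ N * exp (- L * spin_weight n i)"
      by (subst power_minus) simp
  qed
  finally show ?thesis unfolding le N_def by simp
qed

lemma mat_trace_mult_weight_exp:
  assumes "Y \<in> carrier_mat n n"
  shows "mat_trace (Y * weight_exp n s) = (\<Sum>i<n. Y $$ (i, i) * complex_of_real (exp (s * spin_weight n i)))"
proof -
  have "(Y * weight_exp n s) $$ (i, i) = Y $$ (i, i) * complex_of_real (exp (s * spin_weight n i))" if i: "i < n" for i
  proof -
    have "(Y * weight_exp n s) $$ (i, i) = (\<Sum>k<n. if k = i then Y $$ (i, i) * complex_of_real (exp (s * spin_weight n i)) else 0)"
      unfolding mult_mat_entry[OF assms spin_carrier(5) i i]
      by (intro sum.cong refl) (use i in \<open>auto simp: weight_exp_def\<close>)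
    then show ?thesis using i by simp
  qed
  then show ?thesis
    using mat_trace_carrier[OF mult_carrier_mat[OF assms spin_carrier(5)], of s] by simp
qed

lemma mat_trace_cmat: "mat_trace (cmat M) = complex_of_real (mat_trace M)"
  if "M \<in> carrier_mat n n"
  using that by (simp add: mat_trace_def)

section \<open>Differentials evaluated along the geodesic\<close>

context unit_speed_geodesic
begin

definition along :: "nat \<Rightarrow> ('a chart \<Rightarrow> complex \<Rightarrow> complex) \<Rightarrow> real \<Rightarrow> complex" where
  "along k q s = (let c = chart_at \<A> (\<gamma> s) in q c (snd c (\<gamma> s)) * V c s ^ k)"

lemma chart_at: "chart_at \<A> x \<in> \<A>" "x \<in> fst (chart_at \<A> x)"
proof -
  obtain c where "c \<in> \<A> \<and> x \<in> fst c" using exists_chart by blast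
  then have "chart_at \<A> x \<in> \<A> \<and> x \<in> fst (chart_at \<A> x)"
    unfolding chart_at_def by (rule someI)
  then show "chart_at \<A> x \<in> \<A>" "x \<in> fst (chart_at \<A> x)" by auto
qed

lemma along_eq:
  assumes q: "holomorphic_differential \<A> k q" and c: "c \<in> \<A>" "\<gamma> s \<in> fst c"
  shows "along k q s = q c (snd c (\<gamma> s)) * V c s ^ k"
proof -
  let ?d = "chart_at \<A> (\<gamma> s)"
  note d = chart_at[of "\<gamma> s"]
  have "q c (snd c (\<gamma> s)) = q ?d (snd ?d (\<gamma> s)) * deriv (coord_change c ?d) (snd c (\<gamma> s)) ^ k"
    using q c d unfolding holomorphic_differential_def by blast
  then show ?thesis
    unfolding along_def Let_def velocity_chart_change[OF c d] by (simp add: power_mult_distrib)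
qed

text \<open>The chart chosen by \<open>chart_at\<close> may jump along the curve. Near a point one
  fixed chart is used instead, and chart independence identifies the two expressions.\<close>

lemma along_continuous:
  assumes q: "holomorphic_differential \<A> k q"
  shows "isCont (along k q) s"
proof -
  obtain c where c: "c \<in> \<A>" "\<gamma> s \<in> fst c" using exists_chart by blast
  have "open (snd c ` fst c)" using chart[OF c(1)] by (simp add: is_chart_def)
  moreover have "q c holomorphic_on snd c ` fst c"
    using q c unfolding holomorphic_differential_def by blast
  ultimately have "isCont (q c) ((snd c \<circ> \<gamma>) s)"
    using c(2) by (auto dest!: holomorphic_on_imp_continuous_on simp: continuous_on_eq_continuous_at)
  moreover have "isCont (snd c \<circ> \<gamma>) s"
    using has_velocity[OF c] by (rule has_vector_derivative_continuous)
  ultimately have "isCont (\<lambda>r. q c ((snd c \<circ> \<gamma>) r)) s"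
    by (rule Topological_Spaces.isCont_o2[rotated])
  then have "isCont (\<lambda>r. q c (snd c (\<gamma> r)) * V c r ^ k) s"
    using velocity_continuous[OF c] by (intro continuous_intros) simp_all
  moreover have "eventually (\<lambda>r. along k q r = q c (snd c (\<gamma> r)) * V c r ^ k) (nhds s)"
    using eventually_in_chart[OF c] by eventually_elim (rule along_eq[OF q c(1)])
  ultimately show ?thesis by (simp only: isCont_cong)
qed

text \<open>A unit velocity of 2h|dz|^2 has hermitian norm 1/sqrt 2. Normalising k copies gives sqrt
  2^k, and the length element takes one factor back.\<close>

lemma Re_differential_density_eq:
  assumes "1 \<le> k"
  shows "Re_differential_density \<A> h k q \<gamma> s = sqrt 2 ^ (k - 1) * Re (along k q s)"
proof -
  let ?c = "chart_at \<A> (\<gamma> s)"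
  let ?v = "V ?c s"
  have unit: "2 * h ?c (snd ?c (\<gamma> s)) * (cmod ?v)\<^sup>2 = 1"
    by (rule unit_velocity[OF chart_at])
  then have "(K_norm h ?c (snd ?c (\<gamma> s)) ?v) = 1 / sqrt 2"
  proof -
    have "K_norm h ?c (snd ?c (\<gamma> s)) ?v = sqrt (h ?c (snd ?c (\<gamma> s)) * (cmod ?v)\<^sup>2)"
      by (simp add: K_norm_def real_sqrt_mult)
    also have "h ?c (snd ?c (\<gamma> s)) * (cmod ?v)\<^sup>2 = 1 / 2" using unit by simp
    finally show ?thesis by (simp add: real_sqrt_divide)
  qed
  then have "Re_differential_density \<A> h k q \<gamma> s
      = Re (q ?c (snd ?c (\<gamma> s)) * (?v * complex_of_real (sqrt 2)) ^ k) / sqrt 2"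
    by (simp add: Re_differential_density_def Let_def)
  also have "q ?c (snd ?c (\<gamma> s)) * (?v * complex_of_real (sqrt 2)) ^ k
      = complex_of_real (sqrt 2 ^ k) * along k q s"
    by (simp add: along_def Let_def power_mult_distrib mult_ac)
  also have "Re \<dots> = sqrt 2 ^ k * Re (along k q s)" by (simp only: Re_complex_of_real times_complex.sel Im_complex_of_real mult_zero_left diff_zero)
  also have "sqrt 2 ^ k = sqrt 2 ^ (k - 1) * sqrt (2::real)" using assms by (cases k) simp_all
  finally show ?thesis by simp
qed

text \<open>The loop on {0..1} runs with speed len; the substitution s = len r absorbs that
  factor.\<close>

lemma integral_along_loop:
  assumes q: "holomorphic_differential \<A> k q" and k: "1 \<le> k"
  shows "len * integral {0..1} (\<lambda>r. sqrt 2 ^ (k - 1) * Re (along k q (len * r)))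
    = integral {0..len} (Re_differential_density \<A> h k q \<gamma>)"
proof -
  let ?g = "\<lambda>s. sqrt 2 ^ (k - 1) * Re (along k q s)"
  have "continuous_on {0..len} ?g"
    by (intro continuous_intros continuous_at_imp_continuous_on ballI along_continuous[OF q])
  then have "(?g has_integral integral {0..len} ?g) (cbox 0 len)"
    unfolding cbox_interval by (intro integrable_integral integrable_continuous_real)
  from has_integral_affinity'[OF this len_pos, of 0] len_pos
  have "((\<lambda>r. ?g (len * r)) has_integral (1 / len) * integral {0..len} ?g) {0..1}"
    by (simp add: divide_inverse_commute del: integral_mult_right)
  then have "integral {0..1} (\<lambda>r. ?g (len * r)) = (1 / len) * integral {0..len} ?g"
    by (rule integral_unique)
  moreover have "integral {0..len} ?g = integral {0..len} (Re_differential_density \<A> h k q \<gamma>)"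
    by (rule integral_cong) (simp only: Re_differential_density_eq[OF k])
  ultimately show ?thesis using len_pos by simp
qed

end

section \<open>Holonomy and cocycle of the geodesic loop\<close>

context unit_speed_geodesic
begin

context
  fixes n :: nat and c0 :: "'a chart" and P Q :: "complex mat"
  assumes n: "2 \<le> n" and c0: "c0 \<in> \<A>" "\<gamma> 0 \<in> fst c0" and PQ: "inverse_mats n P Q"
begin

abbreviation "t0 \<equiv> frame c0 0"
text \<open>Passes between the identification of the base fibre given by P and Q and the eigenbasis
  of S. The Krawtchouk matrix belongs to the unit frame and must be moved to the chart
  \<open>c0\<close> by the frame value \<open>t0\<close>.\<close>

definition "basis_change = G_transition n t0 (kraw_mat n) * Q"
definition "basis_change_inv = P * G_transition n t0 (kraw_inv n)"

lemma PQ_carrier [simp]: "P \<in> carrier_mat n n" "Q \<in> carrier_mat n n"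
  using PQ by (auto simp: inverse_mats_def)

lemma t0_nonzero: "t0 \<noteq> 0"
  using frame_nonzero[of c0 0] c0 by (simp add: geodesic_loop_def)

lemma frame_periodic: "frame c0 1 = t0"
  using velocity_periodic[OF c0] by (simp add: frame_def)

lemma basis_change_carrier [simp]:
  "basis_change \<in> carrier_mat n n" "basis_change_inv \<in> carrier_mat n n"
  by (simp_all add: basis_change_def basis_change_inv_def mult_carrier_mat[of _ n n _ n])

lemma basis_change_inverse: "inverse_mats n basis_change_inv basis_change"
proof -
  let ?W = "G_transition n t0 (kraw_mat n)" and ?V = "G_transition n t0 (kraw_inv n)"
  note assoc = assoc_mult_mat[of _ n n _ n _ n] and [simp] = mult_carrier_mat[of _ n n _ n]
  have WV: "?W * ?V = 1\<^sub>m n" "?V * ?W = 1\<^sub>m n"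
    using n by (simp_all add: G_transition_mult t0_nonzero kraw_mat_inv)
  have PQ1: "P * Q = 1\<^sub>m n" "Q * P = 1\<^sub>m n" using PQ by (auto simp: inverse_mats_def)
  have "basis_change_inv * basis_change = P * ((?V * ?W) * Q)"
    by (simp add: basis_change_def basis_change_inv_def assoc)
  moreover have "basis_change * basis_change_inv = ?W * ((Q * P) * ?V)"
    by (simp add: basis_change_def basis_change_inv_def assoc)
  ultimately show ?thesis
    by (simp add: inverse_mats_def WV PQ1 left_mult_one_mat[of _ n n])
qed

text \<open>A closed geodesic returns with its initial velocity, so the frame is the same at both
  ends and the trivialisation adds nothing to the holonomy.\<close>

lemma framed_spin_flow_at_base:
  assumes "s = 0 \<or> s = 1"
  shows "P * framed n (spin_flow n L B Y0) c0 s * Q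
    = basis_change_inv * G_transition n t0 (diag_flow n L B Y0 s) * basis_change"
proof -
  note assoc = assoc_mult_mat[of _ n n _ n _ n] and [simp] = mult_carrier_mat[of _ n n _ n]
  have "framed n (spin_flow n L B Y0) c0 s = G_transition n t0 (spin_flow n L B Y0 s)"
    using assms frame_periodic by (auto simp: framed_def)
  also have "\<dots> = G_transition n t0 (kraw_inv n) * G_transition n t0 (diag_flow n L B Y0 s) * G_transition n t0 (kraw_mat n)"
    by (simp add: spin_flow_def G_transition_mult t0_nonzero)
  finally show ?thesis
    by (simp add: basis_change_def basis_change_inv_def assoc)
qed

lemma D_parallel_spin_flow:
  assumes Y0: "Y0 \<in> carrier_mat n n" "mat_trace Y0 = 0"
  shows "D_parallel \<A> n h loop (framed n (spin_flow n len (\<lambda>_. 0\<^sub>m n n) Y0))"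
  unfolding D_parallel_def
proof
  let ?B = "\<lambda>_::real. 0\<^sub>m n n :: complex mat"
  have n0: "0 < n" using n by simp
  have tr0: "mat_trace (0\<^sub>m n n :: complex mat) = 0" by (simp add: mat_trace_def)
  have cont: "continuous_on {0..1} (\<lambda>s. ?B s $$ (i, j))" for i j by simp
  show "G_section_along \<A> n loop (framed n (spin_flow n len ?B Y0))"
    using mat_trace_diag_flow[of ?B n Y0 _ len, OF _ tr0 Y0 cont] mat_trace_spin_flow[OF n0]
    by (intro framed_G_section) simp_all
  have zero: "kraw_inv n * 0\<^sub>m n n * kraw_mat n = 0\<^sub>m n n"
    by (simp add: right_mult_zero_mat[of _ n n] left_mult_zero_mat[of _ n n])
  show "D_along_eq \<A> n h loop (framed n (spin_flow n len ?B Y0)) (\<lambda>_ _ _. 0\<^sub>m n n)"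
  proof (rule framed_D_along_eq[where \<beta> = "\<lambda>_. 0\<^sub>m n n"])
    fix s :: real and i j :: nat assume "0 < s" "s < 1" "i < n" "j < n"
    then show "((\<lambda>s. spin_flow n len ?B Y0 s $$ (i, j)) has_vector_derivative
        complex_of_real len * (0\<^sub>m n n - lie_bracket (spin_mat n) (spin_flow n len ?B Y0 s)) $$ (i, j)) (at s)"
      using spin_flow_ode(2)[of n ?B i j s len Y0, OF n0 _ _ _ cont] by (simp add: zero)
  next
    fix c s
    show "0\<^sub>m n n = complex_of_real len \<cdot>\<^sub>m G_transition n (frame c s) (0\<^sub>m n n)"
      by (rule eq_matI) (auto simp: G_transition_def)
  qed (use spin_flow_ode(1)[of n ?B _ _ len Y0, OF n0 _ _ _ cont] in simp_all)
qed

text \<open>The explicit parallel sections attain every traceless initial value at the base point,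
  so the monodromy condition yields the full adjoint action of the holonomy, namely conjugation by
  the exponential of the weights.\<close>

lemma holonomy_of_loop:
  assumes "is_monodromy_of_D \<A> n h (\<gamma> 0) c0 P Q \<delta>"
  shows "cmat (\<delta> loop) = basis_change_inv * weight_exp n (- len) * basis_change"
proof (rule holonomy_from_adjoint)
  have loops: "loop \<in> pw_C1_loops_at \<A> (\<gamma> 0)" "loop \<in> loops_at (\<gamma> 0)"
    using loop_in_pw_C1_loops by (auto simp: pw_C1_loops_at_def)
  have lift: "lifted_PSL_rep n (\<gamma> 0) \<delta>" using assms by (simp add: is_monodromy_of_D_def)
  then have \<delta>: "\<delta> loop \<in> carrier_mat n n" "Determinant.det (\<delta> loop) = 1"
    "\<And>k. eigenvalue (cmat (\<delta> loop)) k \<Longrightarrow> k \<in> \<real> \<and> Re k > 0"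
    using loops(2) unfolding lifted_PSL_rep_def by blast+
  show "0 < n" using n by simp
  show "cmat (\<delta> loop) \<in> carrier_mat n n" using \<delta>(1) by simp
  show "Determinant.det (cmat (\<delta> loop)) = 1"
    using \<delta>(2) by (simp add: of_real_hom.hom_det)
  show "\<And>k. eigenvalue (cmat (\<delta> loop)) k \<Longrightarrow> k \<in> \<real> \<and> Re k > 0" by (rule \<delta>(3))
  show "inverse_mats n basis_change_inv basis_change" by (rule basis_change_inverse)
  fix Y :: "complex mat" assume Y: "Y \<in> carrier_mat n n" "mat_trace Y = 0"
  \<comment> \<open>Chosen so that the section starts at Y in the chart \<open>c0\<close>; the
    transition by \<open>t0\<close> leaves the diagonal exponentials alone.\<close>
  define Y0 where "Y0 = G_transition n (inverse t0) Y"
  have Y0: "Y0 \<in> carrier_mat n n" "mat_trace Y0 = 0" "G_transition n t0 Y0 = Y"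
    using Y t0_nonzero by (simp_all add: Y0_def G_transition_comp G_transition_by_one)
  let ?u = "framed n (spin_flow n len (\<lambda>_. 0\<^sub>m n n) Y0)"
  have "(P * ?u c0 1 * Q) * cmat (\<delta> loop) = cmat (\<delta> loop) * (P * ?u c0 0 * Q)"
    using assms loops(1) D_parallel_spin_flow[OF Y0(1,2)] unfolding is_monodromy_of_D_def by blast
  moreover have "G_transition n t0 (weight_exp n (- len) * Y0 * weight_exp n len)
      = weight_exp n (- len) * Y * weight_exp n len"
    using Y0 by (simp add: mult_carrier_mat[of _ n n _ n] flip: G_transition_mult[OF t0_nonzero])
  ultimately show "(basis_change_inv * (weight_exp n (- len) * Y * weight_exp n (- (- len))) * basis_change) * cmat (\<delta> loop)
      = cmat (\<delta> loop) * (basis_change_inv * Y * basis_change)"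
    by (simp add: framed_spin_flow_at_base diag_flow_homogeneous[OF Y0(1)] diag_flow_0[OF Y0(1)] Y0(3))
qed

text \<open>The cocycle value is paired with a holonomy that is diagonal in the eigenbasis, so only
  its diagonal entries count, and those are plain integrals of the source. This is the concrete form
  of the holonomy commuting with parallel transport.\<close>

lemma psi0_cocycle_on_loop:
  assumes q: "holomorphic_differential \<A> n q"
  obtains \<xi> where "G_section_along \<A> n loop \<xi>"
    "D_along_eq \<A> n h loop \<xi> (\<lambda>c z v. - psi0 n h n q c z v)"
    "\<xi> c0 0 = 0\<^sub>m n n"
    "mat_trace (P * \<xi> c0 1 * Q * (basis_change_inv * weight_exp n (- len) * basis_change))
      = complex_of_real (2 * (-1) ^ n * fact (n - 1) * sinh (len / 2) ^ (n - 1)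
          * integral {0..len} (Re_differential_density \<A> h n q \<gamma>))"
proof -
  define f where "f s = fact (n - 1) * complex_of_real (sqrt 2) ^ (n - 1) * along n q (len * s)" for s
  \<comment> \<open>The source in the eigenbasis; the sign is that of the cocycle equation, whose
    right side is minus psi^0.\<close>
  define B where "B s = kraw_mat n * corner_mat n (- f s) * kraw_inv n" for s
  let ?Y = "diag_flow n len B (0\<^sub>m n n)"
  define \<xi> where "\<xi> = framed n (spin_flow n len B (0\<^sub>m n n))"
  note assoc = assoc_mult_mat[of _ n n _ n _ n] and c = mult_carrier_mat[of _ n n _ n]
  have n0: "0 < n" using n by simp
  have B: "B s \<in> carrier_mat n n" for s by (simp add: B_def c)
  have f_cont: "continuous_on S f" for S
    unfolding f_def
    by (intro continuous_intros continuous_at_imp_continuous_on ballI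
        Topological_Spaces.isCont_o2[OF _ along_continuous[OF q]])
  have cont: "continuous_on {0..1} (\<lambda>s. B s $$ (i, j))" if ij: "i < n" "j < n" for i j
  proof -
    have "continuous_on {0..1} (\<lambda>s. corner_mat n (- f s) $$ (k, l))" if "k < n" "l < n" for k l
    proof -
      have "continuous_on {0..1} (\<lambda>s. - f s)" "continuous_on {0..1} (\<lambda>s. cnj (- f s))"
        by (intro continuous_intros f_cont)+
      moreover have "(\<lambda>s. corner_mat n (- f s) $$ (k, l)) = (if k = n - 1 \<and> l = 0 then (\<lambda>s. - f s)
          else if k = 0 \<and> l = n - 1 then (\<lambda>s. cnj (- f s)) else (\<lambda>_. 0))"
        using that by (auto simp: corner_mat_def fun_eq_iff)
      ultimately show ?thesis by (simp only: continuous_on_const split: if_split) simp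
    qed
    then show ?thesis
      unfolding B_def triple_product_index[OF spin_carrier(2) corner_mat_carrier spin_carrier(3) ij]
      by (intro continuous_intros) auto
  qed
  have \<beta>: "kraw_inv n * B s * kraw_mat n = corner_mat n (- f s)" for s
  proof -
    have "kraw_inv n * B s * kraw_mat n = (kraw_inv n * kraw_mat n) * corner_mat n (- f s) * (kraw_inv n * kraw_mat n)"
      by (simp add: B_def assoc c)
    then show ?thesis
      by (simp add: kraw_mat_inv[OF n0] left_mult_one_mat[of _ n n] right_mult_one_mat[of _ n n])
  qed
  have trB: "mat_trace (B s) = 0" for s
  proof -
    have "mat_trace (B s) = mat_trace (kraw_inv n * (kraw_mat n * corner_mat n (- f s)))"
      unfolding B_def by (rule mat_trace_mult_commute[of _ n]) (simp_all add: c)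
    also have "kraw_inv n * (kraw_mat n * corner_mat n (- f s)) = (kraw_inv n * kraw_mat n) * corner_mat n (- f s)"
      by (simp add: assoc)
    finally show ?thesis
      by (simp add: kraw_mat_inv[OF n0] left_mult_one_mat[of _ n n] mat_trace_corner[OF n])
  qed
  have "mat_trace (0\<^sub>m n n :: complex mat) = 0" by (simp add: mat_trace_def)
  then have "G_section_along \<A> n loop \<xi>"
    unfolding \<xi>_def using mat_trace_diag_flow[of B n "0\<^sub>m n n" _ len, OF B trB] cont
    by (intro framed_G_section) (simp_all add: mat_trace_spin_flow[OF n0])
  moreover have "D_along_eq \<A> n h loop \<xi> (\<lambda>c z v. - psi0 n h n q c z v)"
    unfolding \<xi>_def
  proof (rule framed_D_along_eq[where \<beta> = "\<lambda>s. corner_mat n (- f s)"])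
    fix s :: real and i j :: nat assume s: "0 < s" "s < 1" and ij: "i < n" "j < n"
    show "((\<lambda>s. spin_flow n len B (0\<^sub>m n n) s $$ (i, j)) has_vector_derivative
        complex_of_real len * (corner_mat n (- f s) - lie_bracket (spin_mat n) (spin_flow n len B (0\<^sub>m n n) s)) $$ (i, j)) (at s)"
      using spin_flow_ode(2)[of n B i j s len "0\<^sub>m n n", OF n0 B ij cont s] unfolding \<beta> by simp
  next
    fix i j :: nat assume ij: "i < n" "j < n"
    show "continuous_on {0..1} (\<lambda>s. spin_flow n len B (0\<^sub>m n n) s $$ (i, j))"
      using spin_flow_ode(1)[of n B i j, OF n0 B ij cont] .
  next
    fix c s assume cs: "c \<in> \<A>" "loop s \<in> fst c"
    then have unit: "2 * h c (snd c (loop s)) * (cmod (V c (len * s)))\<^sup>2 = 1"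
      using unit_velocity[of c "len * s"] by (simp add: geodesic_loop_def)
    have "along n q (len * s) = q c (snd c (loop s)) * V c (len * s) ^ n"
      using along_eq[OF q, of c "len * s"] cs by (simp add: geodesic_loop_def)
    then have "psi0 n h n q c (snd c (loop s)) (velocity c loop s)
        = complex_of_real len \<cdot>\<^sub>m G_transition n (frame c s) (corner_mat n (f s))"
      unfolding loop_velocity[OF cs] psi0_frame[of n h c, OF n unit] frame_def f_def by (simp only:)
    then show "- psi0 n h n q c (snd c (loop s)) (velocity c loop s)
        = complex_of_real len \<cdot>\<^sub>m G_transition n (frame c s) (corner_mat n (- f s))"
      by (intro eq_matI) (auto simp: G_transition_def corner_mat_def)
  qed simp_all
  moreover have "\<xi> c0 0 = 0\<^sub>m n n"
  proof -
    have "spin_flow n len B (0\<^sub>m n n) 0 = 0\<^sub>m n n"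
      by (simp add: spin_flow_def diag_flow_0 right_mult_zero_mat[of _ n n] left_mult_zero_mat[of _ n n])
    then show ?thesis by (intro eq_matI) (auto simp: \<xi>_def framed_def G_transition_def)
  qed
  moreover have "mat_trace (P * \<xi> c0 1 * Q * (basis_change_inv * weight_exp n (- len) * basis_change))
      = complex_of_real (2 * (-1) ^ n * fact (n - 1) * sinh (len / 2) ^ (n - 1)
          * integral {0..len} (Re_differential_density \<A> h n q \<gamma>))"
  proof -
    let ?E = "weight_exp n (- len)" and ?Z = basis_change and ?Zi = basis_change_inv
    let ?G = "G_transition n t0 (?Y 1)"
    define I where "I = integral {0..1} (\<lambda>r. Re (f r))"
    have Z: "?Z * ?Zi = 1\<^sub>m n" using basis_change_inverse by (simp add: inverse_mats_def)
    \<comment> \<open>The two changes of basis cancel in the middle, and cyclicity of the trace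
      removes the outer ones.\<close>
    have "P * \<xi> c0 1 * Q * (?Zi * ?E * ?Z) = ?Zi * ?G * (?Z * ?Zi) * ?E * ?Z"
      by (simp add: \<xi>_def framed_spin_flow_at_base assoc c)
    also have "\<dots> = ?Zi * ((?G * ?E) * ?Z)"
      by (simp add: Z assoc c right_mult_one_mat[of _ n n] left_mult_one_mat[of _ n n])
    finally have "mat_trace (P * \<xi> c0 1 * Q * (?Zi * ?E * ?Z)) = mat_trace (((?G * ?E) * ?Z) * ?Zi)"
      by (simp only:) (rule mat_trace_mult_commute[of _ n]; simp add: c)
    also have "((?G * ?E) * ?Z) * ?Zi = ?G * ?E"
      by (simp add: Z assoc c right_mult_one_mat[of _ n n])
    \<comment> \<open>On the diagonal the transition has exponent 0, so \<open>t0\<close> drops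
      out.\<close>
    also have "mat_trace (?G * ?E) = (\<Sum>i<n. ?Y 1 $$ (i, i) * complex_of_real (exp (- len * spin_weight n i)))"
      by (subst mat_trace_mult_weight_exp) (simp_all add: G_transition_index)
    also have "\<dots> = (\<Sum>i<n. complex_of_real (- 2 * len * I
        * ((-1) ^ i * real ((n - 1) choose i) / 2 ^ (n - 1) * exp (- len * spin_weight n i))))"
    proof (intro sum.cong refl)
      fix i assume "i \<in> {..<n}"
      then have i: "i < n" by simp
      let ?k = "(-1) ^ i * real ((n - 1) choose i) / 2 ^ (n - 1)"
      \<comment> \<open>The initial value is 0 and the weight difference vanishes for equal indices,
        hence no exponential factors remain.\<close>
      have "?Y 1 $$ (i, i) = integral {0..1} (\<lambda>r. complex_of_real len * B r $$ (i, i))"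
        using i by (simp add: diag_flow_def)
      also have "\<dots> = integral {0..1} (\<lambda>r. complex_of_real (- 2 * len * ?k * Re (f r)))"
        by (simp only: B_def kraw_conj_corner_diag[OF n i]) (simp add: mult_ac)
      also have "\<dots> = complex_of_real (integral {0..1} (\<lambda>r. - 2 * len * ?k * Re (f r)))"
        by (intro integral_unique has_integral_of_real integrable_integral
            integrable_continuous_real continuous_intros f_cont)
      also have "integral {0..1} (\<lambda>r. - 2 * len * ?k * Re (f r)) = - 2 * len * ?k * I"
        unfolding I_def by (rule integral_mult_right)
      finally show "?Y 1 $$ (i, i) * complex_of_real (exp (- len * spin_weight n i))
        = complex_of_real (- 2 * len * I * (?k * exp (- len * spin_weight n i)))"
        by (simp only: of_real_mult[symmetric] mult_ac)
    qed
    also have "\<dots> = complex_of_real (- 2 * len * I * (- sinh (len / 2)) ^ (n - 1))"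
      by (simp only: of_real_sum[symmetric] sum_distrib_left[symmetric] sinh_power_weight_sum[OF n0])
    also have "- 2 * len * I * (- sinh (len / 2)) ^ (n - 1)
        = 2 * (-1) ^ n * fact (n - 1) * sinh (len / 2) ^ (n - 1)
          * integral {0..len} (Re_differential_density \<A> h n q \<gamma>)"
    proof -
      have "Re (f r) = fact (n - 1) * (sqrt 2 ^ (n - 1) * Re (along n q (len * r)))" for r
      proof -
        have "f r = complex_of_real (fact (n - 1) * sqrt 2 ^ (n - 1)) * along n q (len * r)"
          by (simp add: f_def)
        then show ?thesis by simp
      qed
      then have "I = fact (n - 1) * integral {0..1} (\<lambda>r. sqrt 2 ^ (n - 1) * Re (along n q (len * r)))"
        unfolding I_def by (simp only: integral_mult_right)
      then have I: "len * I = fact (n - 1) * integral {0..len} (Re_differential_density \<A> h n q \<gamma>)"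
        using integral_along_loop[OF q] n by simp
      \<comment> \<open>The sign (-1)^(n-1) is rewritten as -(-1)^n so that it meets the minus sign
        of the cocycle.\<close>
      have "(- sinh (len / 2)) ^ (n - 1) = - ((-1) ^ n) * sinh (len / 2) ^ (n - 1)"
        using n by (subst power_minus) (cases n; simp)
      then have "- 2 * len * I * (- sinh (len / 2)) ^ (n - 1)
          = 2 * (-1) ^ n * sinh (len / 2) ^ (n - 1) * (len * I)" by simp
      then show ?thesis unfolding I by (simp only: mult_ac)
    qed
    finally show ?thesis .
  qed
  ultimately show ?thesis using that by blast
qed

end

end

theorem corollary4p0p3:
  fixes \<A> :: "'a::t2_space chart set"
    and h :: "'a chart \<Rightarrow> complex \<Rightarrow> real"
    and q :: "'a chart \<Rightarrow> complex \<Rightarrow> complex"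
    and \<gamma> :: "real \<Rightarrow> 'a" and len :: real
    and n genus :: nat
    and c0 :: "'a chart" and P Q :: "complex mat"
    and R :: "real \<Rightarrow> (real \<Rightarrow> 'a) \<Rightarrow> real mat"
  assumes "closed_riemann_surface \<A>"
    and "has_genus TYPE('a) genus" and "genus \<ge> 2"
    and "hyperbolic_metric \<A> h"
    and "n \<ge> 2"
    and "holomorphic_differential \<A> n q"
    and "closed_geodesic \<A> h \<gamma> len"
    and "c0 \<in> \<A>" and "\<gamma> 0 \<in> fst c0" and "inverse_mats n P Q"
    and "is_monodromy_of_D \<A> n h (\<gamma> 0) c0 P Q (R 0)"
    and "\<forall>\<^sub>F t in nhds 0. R t \<in> hitchin_reps n (\<gamma> 0) (R 0)"
    and "tangent_class_of_form \<A> n h (\<gamma> 0) c0 P Q R (psi0 n h n q)"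
  shows "((\<lambda>t. mat_trace (R t (geodesic_loop \<gamma> len))) has_real_derivative
           2 * (- 1) ^ n * fact (n - 1) * sinh (len / 2) ^ (n - 1) *
             integral {0..len} (Re_differential_density \<A> h n q \<gamma>)) (at 0)"
proof -
  interpret unit_speed_geodesic \<A> h \<gamma> len
    by unfold_locales (use assms in \<open>auto simp: closed_riemann_surface_def\<close>)
  let ?val = "2 * (- 1) ^ n * fact (n - 1) * sinh (len / 2) ^ (n - 1) *
             integral {0..len} (Re_differential_density \<A> h n q \<gamma>)"
  note ctx = \<open>n \<ge> 2\<close> \<open>c0 \<in> \<A>\<close> \<open>\<gamma> 0 \<in> fst c0\<close> \<open>inverse_mats n P Q\<close>
  have C1: "loop \<in> pw_C1_loops_at \<A> (\<gamma> 0)" by (rule loop_in_pw_C1_loops)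
  then have loop: "loop \<in> loops_at (\<gamma> 0)" by (simp add: pw_C1_loops_at_def)
  have carrier: "eventually (\<lambda>t. R t loop \<in> carrier_mat n n) (nhds 0)"
    using assms(12)
  proof eventually_elim
    case (elim t)
    then obtain r where r: "lifted_PSL_rep n (\<gamma> 0) (r (1::real))" "r 1 loop = R t loop"
      unfolding hitchin_reps_def using loop by force
    then show ?case using loop unfolding lifted_PSL_rep_def by metis
  qed
  then have R0: "R 0 loop \<in> carrier_mat n n" by (rule eventually_nhds_x_imp_x)
  let ?D = "rep_path_velocity n R loop"
  have D: "?D \<in> carrier_mat n n" by (simp add: rep_path_velocity_def)
  have "((\<lambda>t. R t loop $$ (i, i)) has_real_derivative ?D $$ (i, i)) (at 0)" if "i < n" for i
  proof -
    have "(\<lambda>t. R t loop $$ (i, i)) differentiable (at 0)"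
      using assms(13) loop that unfolding tangent_class_of_form_def by blast
    then have "((\<lambda>t. R t loop $$ (i, i)) has_real_derivative deriv (\<lambda>t. R t loop $$ (i, i)) 0) (at 0)"
      by (metis DERIV_deriv_iff_real_differentiable)
    then show ?thesis using that by (simp add: rep_path_velocity_def)
  qed
  then have "((\<lambda>t. \<Sum>i<n. R t loop $$ (i, i)) has_real_derivative mat_trace ?D) (at 0)"
    unfolding mat_trace_carrier[OF D] by (intro DERIV_sum) auto
  \<comment> \<open>\<open>mat_trace\<close> sums up to the row dimension of its argument, which is
    known to be n only for t near 0.\<close>
  moreover have "eventually (\<lambda>t. mat_trace (R t loop) = (\<Sum>i<n. R t loop $$ (i, i))) (nhds 0)"
    using carrier by eventually_elim (rule mat_trace_carrier)
  ultimately have "((\<lambda>t. mat_trace (R t loop)) has_real_derivative mat_trace ?D) (at 0)"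
    by (subst DERIV_cong_ev[OF refl _ refl])
  moreover have "mat_trace ?D = ?val"
  proof -
    obtain Bm where Bm: "Bm \<in> carrier_mat n n"
      and cocycle: "\<And>\<xi>. G_section_along \<A> n loop \<xi> \<and>
          D_along_eq \<A> n h loop \<xi> (\<lambda>c z v. - psi0 n h n q c z v) \<and> \<xi> c0 0 = 0\<^sub>m n n \<Longrightarrow>
          cmat ?D = (P * \<xi> c0 1 * Q) * cmat (R 0 loop) + cmat (Bm * R 0 loop - R 0 loop * Bm)"
      using assms(13) C1 unfolding tangent_class_of_form_def by blast
    obtain \<xi> where \<xi>: "G_section_along \<A> n loop \<xi>"
      "D_along_eq \<A> n h loop \<xi> (\<lambda>c z v. - psi0 n h n q c z v)" "\<xi> c0 0 = 0\<^sub>m n n"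
      and trace: "mat_trace (P * \<xi> c0 1 * Q * (basis_change_inv n c0 P * weight_exp n (- len) * basis_change n c0 Q))
        = complex_of_real ?val"
      using psi0_cocycle_on_loop[OF ctx assms(6)] by blast
    have "complex_of_real (mat_trace ?D) = mat_trace ((P * \<xi> c0 1 * Q) * cmat (R 0 loop)
        + cmat (Bm * R 0 loop - R 0 loop * Bm))"
      using mat_trace_cmat[OF D] cocycle[of \<xi>] \<xi> by simp
    also have "\<dots> = mat_trace ((P * \<xi> c0 1 * Q) * cmat (R 0 loop)) + mat_trace (cmat (Bm * R 0 loop - R 0 loop * Bm))"
    proof (rule mat_trace_add[of _ n])
      show "cmat (Bm * R 0 loop - R 0 loop * Bm) \<in> carrier_mat n n"
        using Bm R0 by (simp add: minus_carrier_mat)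
      have "\<xi> c0 1 \<in> carrier_mat n n"
      proof -
        have "loop 1 \<in> fst c0" using ctx(3) periodic[of 0] by (simp add: geodesic_loop_def)
        moreover have "\<forall>c\<in>\<A>. \<forall>s\<in>{0..1}. loop s \<in> fst c \<longrightarrow> \<xi> c s \<in> carrier_mat n n \<and> mat_trace (\<xi> c s) = 0"
          using \<xi>(1) unfolding G_section_along_def by (rule conjunct1)
        ultimately show ?thesis using ctx(2) by simp
      qed
      then show "P * \<xi> c0 1 * Q * cmat (R 0 loop) \<in> carrier_mat n n"
        using ctx(4) R0 by (simp add: inverse_mats_def mult_carrier_mat[of _ n n _ n])
    qed
    \<comment> \<open>The coboundary term is a commutator, so the derivative of the trace depends
      only on the cohomology class.\<close>
    also have "mat_trace (cmat (Bm * R 0 loop - R 0 loop * Bm)) = 0"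
    proof -
      have "Bm * R 0 loop \<in> carrier_mat n n" "R 0 loop * Bm \<in> carrier_mat n n"
        using Bm R0 by auto
      then show ?thesis
        using mat_trace_mult_commute[OF Bm R0]
        by (simp add: mat_trace_cmat[of _ n] mat_trace_diff[of _ n] minus_carrier_mat)
    qed
    also have "mat_trace ((P * \<xi> c0 1 * Q) * cmat (R 0 loop)) = complex_of_real ?val"
      unfolding holonomy_of_loop[OF ctx assms(11)] by (rule trace)
    finally show ?thesis by (simp only: add_0_right of_real_eq_iff)
  qed
  ultimately show ?thesis by simp
qed

end
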